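(* Let $n\ge2$ be an integer, $\gamma\in(-\infty,-n)\cup(0,\infty)$, and $\Omega\in L(\log L)(\mathbb{S}^{n-1})$. Then there exists a positive constant $C$, depending only on $n$ and $\gamma$, such that, for any $f\in L^1(\mathbb{R}^n)$, $$\sup_{\lambda\in(0,\infty)}\lambda\int_{\mathbb{R}^n}\left[\int_{\{t\in(0,\infty):\,\mathcal{M}^\ast_\Omega(f)(x,t)>\lambda t^\gamma\}}t^{\gamma-1}\,dt\right]dx\le C\left(1+|\Omega|_{L(\log L)(\mathbb{S}^{n-1})}\right)\|f\|_{L^1(\mathbb{R}^n)}.$$
   Context: $\mathbb{S}^{n-1}$ is the unit sphere of $\mathbb{R}^n$ with surface measure $\sigma$. $\Omega\in L(\log L)(\mathbb{S}^{n-1})$ means that $\Omega$ is measurable and $$|\Omega|_{L(\log L)(\mathbb{S}^{n-1})}:=\int_{\mathbb{S}^{n-1}}|\Omega(\xi)|\,[1+\log^+|\Omega(\xi)|]\,d\sigma(\xi)<\infty,\qquad \log^+z:=\max\{0,\log z\}.$$ For $\omega\in\mathbb{S}^{n-1}$, $f\in L^1_{\rm loc}(\mathbb{R}^n)$ and $(x,t)\in\mathbb{R}^n\times(0,\infty)$, the lifted directional maximal operator is $$\mathcal{M}_\omega(f)(x,t):=\sup_{r\in[t,2t)}\frac{1}{2r}\int_{-r}^r|f(x-s\omega)|\,ds,$$ and the lifted operator $\mathcal{M}^\ast_\Omega$ is $$\mathcal{M}^\ast_\Omega(f)(x,t):=\int_{\mathbb{S}^{n-1}}|\Omega(\omega)|\,\mathcal{M}_\omega(f)(x,t)\,d\sigma(\omega).$$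 *)

theory Defs
  imports "HOL-Analysis.Analysis"
begin

(* The unit sphere with its surface measure, given by the cone formula
   sigma(A) = n * Leb {r *R w | 0 < r < 1, w in A}
   (see lemma emeasure_sphere_borel below), first on the Borel sets and then completed. *)

definition sphere_borel_measure :: "(real ^ 'n) measure" where
  "sphere_borel_measure =
     scale_measure (ennreal (real CARD('n)))
       (distr (restrict_space lborel (ball 0 1 - {0})) (restrict_space borel (sphere 0 1))
          (\<lambda>x. x /\<^sub>R norm x))"

definition sphere_measure :: "(real ^ 'n) measure" where
  "sphere_measure = completion sphere_borel_measure"

lemma space_sphere_measure: "space sphere_measure = sphere (0 :: real ^ 'n) 1"
  by (simp add: sphere_measure_def sphere_borel_measure_def space_scale_measure space_restrict_space)

lemma emeasure_sphere_borel:
  fixes A :: "(real ^ 'n) set"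
  assumes "A \<in> sets borel" "A \<subseteq> sphere 0 1"
  shows "emeasure sphere_measure A =
     ennreal (real CARD('n)) * emeasure lborel {r *\<^sub>R w | r w. 0 < r \<and> r < 1 \<and> w \<in> A}"
proof -
  have S: "A \<in> sets (restrict_space borel (sphere (0 :: real ^ 'n) 1))"
    using assms by (subst sets_restrict_space_iff) auto
  have meas: "(\<lambda>x. x /\<^sub>R norm x) \<in> measurable (restrict_space lborel (ball (0 :: real ^ 'n) 1 - {0}))
      (restrict_space borel (sphere 0 1))"
    by (intro measurable_restrict_space2 measurable_restrict_space1) (auto simp: space_restrict_space)
  have eq: "(\<lambda>x. x /\<^sub>R norm x) -` A \<inter> space (restrict_space lborel (ball (0 :: real ^ 'n) 1 - {0})) =
      {r *\<^sub>R w | r w. 0 < r \<and> r < 1 \<and> w \<in> A}" (is "?L = ?R")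
  proof (intro equalityI subsetI)
    fix x assume "x \<in> ?L"
    then have "x = norm x *\<^sub>R (x /\<^sub>R norm x)" "0 < norm x" "norm x < 1" "x /\<^sub>R norm x \<in> A"
      by (auto simp: space_restrict_space)
    then show "x \<in> ?R" by blast
  next
    fix x assume "x \<in> ?R"
    then obtain r w where x: "x = r *\<^sub>R w" "0 < r" "r < 1" "w \<in> A" by blast
    then have "norm w = 1" using assms by auto
    then show "x \<in> ?L" using x by (auto simp: space_restrict_space)
  qed
  have "emeasure sphere_measure A = emeasure sphere_borel_measure A"
    using S by (simp add: sphere_measure_def sphere_borel_measure_def)
  also have "\<dots> = ennreal (real CARD('n)) * emeasure (restrict_space lborel (ball (0 :: real ^ 'n) 1 - {0})) ?R"
    using emeasure_distr[OF meas S] eq by (simp add: sphere_borel_measure_def)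
  also have "\<dots> = ennreal (real CARD('n)) * emeasure lborel ?R"
    by (subst emeasure_restrict_space) (auto simp: eq[symmetric] space_restrict_space)
  finally show ?thesis .
qed

(* Since ln 0 = 0, this also gives log_plus 0 = 0. *)
definition log_plus :: "real \<Rightarrow> real" where
  "log_plus z = max 0 (ln z)"

definition LlogL_norm :: "(real ^ 'n \<Rightarrow> real) \<Rightarrow> ennreal" where
  "LlogL_norm \<Omega> = (\<integral>\<^sup>+\<xi>. ennreal (\<bar>\<Omega> \<xi>\<bar> * (1 + log_plus \<bar>\<Omega> \<xi>\<bar>)) \<partial>sphere_measure)"

definition LlogL :: "(real ^ 'n \<Rightarrow> real) set" where
  "LlogL = {\<Omega>. \<Omega> \<in> borel_measurable sphere_measure \<and> LlogL_norm \<Omega> < \<infinity>}"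

(* The maximal operators take values in [0,\<infinity>], so that no finiteness of the line integrals,
   which may fail on a null set of x, needs to be assumed. *)

definition lifted_directional_maximal ::
  "real ^ 'n \<Rightarrow> (real ^ 'n \<Rightarrow> real) \<Rightarrow> real ^ 'n \<Rightarrow> real \<Rightarrow> ennreal" where
  "lifted_directional_maximal \<omega> f x t =
     (SUP r\<in>{t..<2 * t}. ennreal (1 / (2 * r)) *
        (\<integral>\<^sup>+s\<in>{- r..r}. ennreal \<bar>f (x - s *\<^sub>R \<omega>)\<bar> \<partial>lebesgue))"

definition lifted_maximal ::
  "(real ^ 'n \<Rightarrow> real) \<Rightarrow> (real ^ 'n \<Rightarrow> real) \<Rightarrow> real ^ 'n \<Rightarrow> real \<Rightarrow> ennreal" where
  "lifted_maximal \<Omega> f x t =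
     (\<integral>\<^sup>+\<omega>. ennreal \<bar>\<Omega> \<omega>\<bar> * lifted_directional_maximal \<omega> f x t \<partial>sphere_measure)"

end

theory Submission
  imports Defs
begin

text \<open>
  Write \<open>n\<close> for the dimension. For \<open>t\<close> in the dyadic interval \<open>[2^k, 2^(k+1))\<close> the lifted operator
  only involves segments of length comparable to \<open>2^k\<close> (\<open>lifted_maximal_le_segmental\<close>). Cutting these
  segments into the shells \<open>2^(i-1) < \<bar>s\<bar> \<le> 2^i\<close> reduces everything to the averages
    \<open>A_i f x = 2^-i * (integral over directions u of \<bar>\<Omega> u\<bar> * (integral over shell i of \<bar>f (x - s u)\<bar> ds))\<close>,
  because the shell \<open>i = k + 2 - m\<close> enters with the factor \<open>2^-m\<close>, which pays for the summation over \<open>m\<close>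
  in weak \<open>L^1\<close> (\<open>segmental_weak_type\<close>). What has to be shown is therefore
    \<open>(\<Sum>k. 2^(\<gamma> k) * \<bar>{x. A_k f x > \<mu> * 2^(\<gamma> k)}\<bar>) \<le> C / \<mu> * (1 + \<bar>\<Omega>\<bar>) * \<bar>f\<bar>\<close>,
  with the \<open>L log L\<close> norm of \<open>\<Omega>\<close> and the \<open>L^1\<close> norm of \<open>f\<close> on the right (\<open>level_sum_weak_type\<close>).

  By Chebyshev each single \<open>k\<close> contributes at most a multiple of \<open>1 / \<mu>\<close>; the point is to sum over
  all scales. This is done with exceptional sets \<open>G_k\<close>, unions of dyadic cubes of side \<open>2^k\<close> with
  \<open>(\<Sum>k. 2^(\<gamma> k) * \<bar>G_k\<bar>) \<le> C * \<bar>f\<bar>\<close>, and with weights \<open>w_k\<close> (\<open>weak_type_of_weights\<close>). Away from the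
  neighbours of \<open>G_k\<close>, the part of \<open>A_k f\<close> where \<open>\<bar>\<Omega> u\<bar> \<le> w_k z\<close>, with \<open>z = x - s u\<close>, is dominated in polar
  coordinates by an ordinary average of \<open>w_k * f\<close> over a ball, and the weights are so small that
  this is at most a fixed multiple of \<open>2^(\<gamma> k)\<close> pointwise; it stays below the level if \<open>\<mu>\<close> is chosen large,
  and scaling \<open>f\<close> yields all other \<open>\<mu>\<close>. The part where
  \<open>\<bar>\<Omega> u\<bar> > w_k z\<close> is estimated in \<open>L^1\<close>. The weights are so large that, for fixed \<open>u\<close> and \<open>z\<close>, this part is
  present for at most \<open>C * (1 + log\<^sup>+ \<bar>\<Omega> u\<bar>)\<close> values of \<open>k\<close>, and summation over \<open>k\<close> produces the
  \<open>L log L\<close> norm. Weights that are small and large enough at the same time exist because the power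
  \<open>t^\<gamma>\<close> in the level separates the scales geometrically.

  It remains to find \<open>G_k\<close> and \<open>w_k\<close>. Let \<open>m_k z\<close> be the integral of \<open>f\<close> over the dyadic cube of side
  \<open>2^k\<close> that contains \<open>z\<close>, and call this cube heavy if \<open>m_k z > 2^(k (\<gamma> + n))\<close>. If \<open>\<gamma> < -n\<close>, the ratio
  \<open>\<rho>_k z = m_k z / 2^(k (\<gamma> + n))\<close> grows geometrically in \<open>k\<close> because the cubes are nested; one takes for
  \<open>G_k\<close> the union of the heavy cubes and \<open>w_k = 1 / \<rho>_k\<close> (\<open>weak_type_negative\<close>). If \<open>\<gamma> > 0\<close>, one takes for \<open>G_k\<close>
  the union of the heavy cubes of side at least \<open>2^k\<close>; outside \<open>G_j\<close> the density of \<open>f\<close> at scale \<open>j\<close> is at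
  most \<open>2^(\<gamma> j)\<close>, which decays as \<open>j\<close> decreases, so that \<open>f\<close> can afford the weight \<open>2^(\<gamma> (k - j) / 2)\<close> there
  (\<open>weak_type_positive\<close>).
\<close>

section \<open>Surface measure and polar coordinates\<close>

lemma nn_integral_lborel_affine:
  fixes h :: "'a::euclidean_space \<Rightarrow> ennreal"
  assumes [measurable]: "h \<in> borel_measurable borel" and "c \<noteq> 0"
  shows "(\<integral>\<^sup>+x. h x \<partial>lborel) = ennreal (\<bar>c\<bar> ^ DIM('a)) * (\<integral>\<^sup>+x. h (t + c *\<^sub>R x) \<partial>lborel)"
  by (subst lborel_affine[OF assms(2), of t])
     (simp add: nn_integral_density nn_integral_distr nn_integral_cmult)

text \<open>
  The surface measure, regarded as a Borel measure on the whole space. Since its sigma-algebra is the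
  Borel one, Tonelli's theorem applies to it and Lebesgue measure for all Borel kernels on pairs of points
  of the space.
\<close>

definition surf :: "(real ^ 'n) measure" where
  "surf = distr sphere_borel_measure borel (\<lambda>x. x)"

lemma sets_surf [measurable_cong, simp]: "sets surf = sets borel"
  by (simp add: surf_def)

lemma space_surf [simp]: "space surf = UNIV"
  by (simp add: surf_def)

lemma sets_sphere_borel_measure:
  "sets (sphere_borel_measure :: (real ^ 'n) measure) = sets (restrict_space borel (sphere 0 1))"
  by (simp add: sphere_borel_measure_def)

lemma measurable_sphere_borel_measure:
  fixes h :: "real ^ 'n \<Rightarrow> 'b::topological_space"
  assumes "h \<in> borel_measurable borel"
  shows "h \<in> borel_measurable (sphere_borel_measure :: (real ^ 'n) measure)"
  using assms
  by (subst measurable_cong_sets[OF sets_sphere_borel_measure refl]) (rule measurable_restrict_space1)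

lemma measurable_id_sphere_borel_measure:
  "(\<lambda>x. x) \<in> (sphere_borel_measure :: (real ^ 'n) measure) \<rightarrow>\<^sub>M borel"
  by (rule measurable_sphere_borel_measure) simp

lemma nn_integral_surf:
  fixes h :: "real ^ 'n \<Rightarrow> ennreal"
  assumes "h \<in> borel_measurable borel"
  shows "(\<integral>\<^sup>+w. h w \<partial>surf) = (\<integral>\<^sup>+w. h w \<partial>sphere_measure)"
  using assms
  by (simp add: surf_def sphere_measure_def nn_integral_completion nn_integral_distr
      measurable_id_sphere_borel_measure)

lemma nn_integral_surf_eq_ball:
  fixes h :: "real ^ 'n \<Rightarrow> ennreal"
  assumes [measurable]: "h \<in> borel_measurable borel"
  shows "(\<integral>\<^sup>+w. h w \<partial>surf) =
    ennreal (real CARD('n)) * (\<integral>\<^sup>+x. h (x /\<^sub>R norm x) * indicator (ball 0 1 - {0}) x \<partial>lborel)"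
proof -
  have meas: "(\<lambda>x. x /\<^sub>R norm x) \<in> measurable (restrict_space lborel (ball (0 :: real ^ 'n) 1 - {0}))
      (restrict_space borel (sphere 0 1))"
    by (intro measurable_restrict_space2 measurable_restrict_space1) (auto simp: space_restrict_space)
  have h: "h \<in> borel_measurable (restrict_space borel (sphere 0 1))"
    by (intro measurable_restrict_space1) simp
  have "(\<integral>\<^sup>+w. h w \<partial>surf) = (\<integral>\<^sup>+w. h w \<partial>sphere_borel_measure)"
    by (simp add: surf_def nn_integral_distr measurable_id_sphere_borel_measure)
  also have "\<dots> = ennreal (real CARD('n)) *
      (\<integral>\<^sup>+w. h w \<partial>distr (restrict_space lborel (ball 0 1 - {0})) (restrict_space borel (sphere 0 1))
          (\<lambda>x. x /\<^sub>R norm x))"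
    unfolding sphere_borel_measure_def using h by (subst nn_integral_scale_measure) (auto cong: measurable_cong_sets)
  also have "\<dots> = ennreal (real CARD('n)) *
      (\<integral>\<^sup>+x. h (x /\<^sub>R norm x) \<partial>restrict_space lborel (ball 0 1 - {0}))"
    by (subst nn_integral_distr[OF meas]) (use h in simp_all)
  finally show ?thesis
    by (simp add: nn_integral_restrict_space)
qed

lemma emeasure_surf_finite: "emeasure (surf :: (real ^ 'n) measure) UNIV < \<infinity>"
proof -
  have "emeasure (surf :: (real ^ 'n) measure) UNIV = (\<integral>\<^sup>+w. 1 \<partial>(surf :: (real ^ 'n) measure))"
    by simp
  also have "\<dots> = ennreal (real CARD('n)) * (\<integral>\<^sup>+x. 1 * indicator (ball 0 1 - {0}) (x :: real ^ 'n) \<partial>lborel)"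
    by (subst nn_integral_surf_eq_ball) simp_all
  finally have eq: "emeasure (surf :: (real ^ 'n) measure) UNIV =
    ennreal (real CARD('n)) * (\<integral>\<^sup>+x. 1 * indicator (ball 0 1 - {0}) (x :: real ^ 'n) \<partial>lborel)" .
  have "(\<integral>\<^sup>+x. 1 * indicator (ball 0 1 - {0}) (x :: real ^ 'n) \<partial>lborel) \<le> emeasure lborel (ball (0 :: real ^ 'n) 1)"
    by (auto intro!: emeasure_mono)
  then have "(\<integral>\<^sup>+x. 1 * indicator (ball 0 1 - {0}) (x :: real ^ 'n) \<partial>lborel) < \<infinity>"
    using emeasure_lborel_ball_finite by (rule order.strict_trans1)
  then show ?thesis
    unfolding eq by (simp add: ennreal_mult_less_top)
qed

lemma sigma_finite_surf: "sigma_finite_measure (surf :: (real ^ 'n) measure)"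
proof -
  have "finite_measure (surf :: (real ^ 'n) measure)"
    by (rule finite_measureI) (use emeasure_surf_finite in \<open>auto simp: less_top[symmetric]\<close>)
  then show ?thesis
    by (simp add: finite_measure_def)
qed

lemma AE_surf_norm: "AE w in (surf :: (real ^ 'n) measure). norm w = 1"
  unfolding surf_def
  by (subst AE_distr_iff[OF measurable_id_sphere_borel_measure])
     (auto simp: sphere_borel_measure_def space_scale_measure space_restrict_space)

lemma nn_integral_swap:
  assumes "sigma_finite_measure M" "sigma_finite_measure N" "case_prod h \<in> borel_measurable (M \<Otimes>\<^sub>M N)"
  shows "(\<integral>\<^sup>+x. \<integral>\<^sup>+y. h x y \<partial>N \<partial>M) = (\<integral>\<^sup>+y. \<integral>\<^sup>+x. h x y \<partial>M \<partial>N)"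
  using pair_sigma_finite.Fubini'[OF pair_sigma_finite.intro[OF assms(1,2)] assms(3)] by simp

text \<open>
  The radial integral that remains when the cone formula for the surface measure is turned into
  polar coordinates.
\<close>

lemma nn_integral_inverse_power_tail:
  fixes c :: real
  assumes "c > 0" "n > 0"
  shows "(\<integral>\<^sup>+u. ennreal (1 / u ^ (n + 1)) * indicator {c..} u \<partial>lborel) = ennreal (1 / (real n * c ^ n))"
proof -
  have "(\<integral>\<^sup>+u. ennreal (1 / u ^ (n + 1)) * indicator {c..} u \<partial>lborel) = ennreal (0 - (- (1 / (real n * c ^ n))))"
  proof (rule nn_integral_FTC_atLeast)
    fix x assume "c \<le> x"
    then have "x > 0" using assms by simp
    obtain m where m: "n = Suc m" using assms(2) gr0_implies_Suc by blast
    show "((\<lambda>x. - (1 / (real n * x ^ n))) has_real_derivative 1 / x ^ (n + 1)) (at x)"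
    proof -
      have "((\<lambda>x. - (1 / real n) * inverse x ^ n) has_real_derivative
          - (1 / real n) * (real n * (- (inverse x ^ Suc (Suc 0)) * inverse x ^ (n - Suc 0)))) (at x)"
        using \<open>x > 0\<close> by (intro DERIV_cmult DERIV_power DERIV_inverse) simp
      moreover have "- (1 / real n) * (real n * (- (inverse x ^ Suc (Suc 0)) * inverse x ^ (n - Suc 0))) = 1 / x ^ (n + 1)"
        using assms(2) \<open>x > 0\<close> by (simp add: m field_simps)
      moreover have "- (1 / real n) * inverse x ^ n = - (1 / (real n * x ^ n))" for x :: real
        by (simp add: field_simps)
      ultimately show ?thesis by simp
    qed
  next
    have "((\<lambda>x::real. inverse (x ^ n)) \<longlongrightarrow> 0) at_top"
      using assms(2) by (intro tendsto_inverse_0_at_top filterlim_pow_at_top filterlim_ident)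
    then have "((\<lambda>x::real. - (1 / real n) * inverse (x ^ n)) \<longlongrightarrow> - (1 / real n) * 0) at_top"
      by (intro tendsto_mult tendsto_const)
    then show "((\<lambda>x::real. - (1 / (real n * x ^ n))) \<longlongrightarrow> 0) at_top"
      by (simp add: field_simps)
  qed (use assms in auto)
  then show ?thesis by simp
qed

text \<open>
  The inequality between polar and Cartesian coordinates on the shell \<open>a < \<bar>z\<bar> \<le> 2 a\<close>. By the cone
  formula the left-hand side is an integral over the unit ball; the substitutions \<open>s = u \<bar>x\<bar>\<close> on the line
  and \<open>z = u x\<close> in space turn it into an integral over \<open>z\<close> and \<open>u > \<bar>z\<bar>\<close> of \<open>h z * \<bar>z\<bar> / u^(n+1)\<close>. On the shell
  \<open>\<bar>z\<bar> \<le> 2 a\<close>, and the remaining integral over \<open>u \<ge> a\<close> is \<open>1 / (n a^n)\<close>, whose \<open>n\<close> cancels against the factor in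
  the cone formula.
\<close>

lemma polar_shell_bound:
  fixes h :: "real ^ 'n \<Rightarrow> ennreal"
  assumes [measurable]: "h \<in> borel_measurable borel" and "a > 0"
  shows "(\<integral>\<^sup>+w. \<integral>\<^sup>+s. h (s *\<^sub>R w) * indicator {a<..2 * a} s \<partial>lborel \<partial>surf) \<le>
    ennreal (2 * a / a ^ CARD('n)) * (\<integral>\<^sup>+z. h z * indicator (cball 0 (2 * a)) z \<partial>lborel)"
proof -
  define n where "n = CARD('n)"
  define B where "B = (ball 0 1 - {0} :: (real ^ 'n) set)"
  have [measurable]: "B \<in> sets borel" by (auto simp: B_def)
  let ?I = "\<integral>\<^sup>+z. h z * indicator (cball 0 (2 * a)) z \<partial>lborel"
  have [measurable]: "cball 0 (2 * a) \<in> sets (borel :: (real ^ 'n) measure)" by simp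
  have n: "n > 0" by (simp add: n_def)
  have "(\<integral>\<^sup>+w. \<integral>\<^sup>+s. h (s *\<^sub>R w) * indicator {a<..2 * a} s \<partial>lborel \<partial>surf) =
    ennreal (real n) *
      (\<integral>\<^sup>+x. (\<integral>\<^sup>+s. h (s *\<^sub>R (x /\<^sub>R norm x)) * indicator {a<..2 * a} s \<partial>lborel) * indicator B x \<partial>lborel)"
    unfolding n_def B_def by (subst nn_integral_surf_eq_ball) auto
  also have "(\<integral>\<^sup>+x. (\<integral>\<^sup>+s. h (s *\<^sub>R (x /\<^sub>R norm x)) * indicator {a<..2 * a} s \<partial>lborel) * indicator B x \<partial>lborel)
     \<le> (\<integral>\<^sup>+x. \<integral>\<^sup>+u. ennreal (norm x) * (h (u *\<^sub>R x) * indicator {a<..2 * a} (u * norm x) * indicator B x) \<partial>lborel \<partial>lborel)"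
  proof (intro nn_integral_mono)
    fix x :: "real ^ 'n"
    show "(\<integral>\<^sup>+s. h (s *\<^sub>R (x /\<^sub>R norm x)) * indicator {a<..2 * a} s \<partial>lborel) * indicator B x
      \<le> (\<integral>\<^sup>+u. ennreal (norm x) * (h (u *\<^sub>R x) * indicator {a<..2 * a} (u * norm x) * indicator B x) \<partial>lborel)"
    proof (cases "x = 0")
      case False
      then show ?thesis
        by (subst nn_integral_real_affine[where c="norm x" and t=0])
           (auto simp: nn_integral_cmult nn_integral_multc ac_simps indicator_def B_def)
    qed (simp add: B_def)
  qed
  also have "\<dots> = (\<integral>\<^sup>+u. \<integral>\<^sup>+x. ennreal (norm x) * (h (u *\<^sub>R x) * indicator {a<..2 * a} (u * norm x) * indicator B x) \<partial>lborel \<partial>lborel)"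
    by (intro nn_integral_swap sigma_finite_lborel) measurable
  \<comment> \<open>The range \<open>u < a\<close> drops out because \<open>\<bar>x\<bar> < 1\<close>. For \<open>u \<ge> a\<close>, the substitution \<open>z = u x\<close> yields
    \<open>1 / u^n\<close>, and \<open>\<bar>x\<bar> \<le> 2 a / u\<close> yields one more power of \<open>u\<close>.\<close>
  also have "\<dots> \<le> (\<integral>\<^sup>+u. ennreal (1 / u ^ (n + 1)) * indicator {a..} u * (ennreal (2 * a) * ?I) \<partial>lborel)"
  proof (intro nn_integral_mono)
    fix u :: real
    show "(\<integral>\<^sup>+x. ennreal (norm x) * (h (u *\<^sub>R x) * indicator {a<..2 * a} (u * norm x) * indicator B x) \<partial>lborel)
      \<le> ennreal (1 / u ^ (n + 1)) * indicator {a..} u * (ennreal (2 * a) * ?I)"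
    proof (cases "u \<ge> a")
      case True
      then have u: "u > 0" using assms by simp
      have "(\<integral>\<^sup>+x. ennreal (norm x) * (h (u *\<^sub>R x) * indicator {a<..2 * a} (u * norm x) * indicator B x) \<partial>lborel)
        \<le> (\<integral>\<^sup>+x. ennreal (2 * a / u) * (h (u *\<^sub>R x) * indicator (cball 0 (2 * a)) (u *\<^sub>R x)) \<partial>lborel)"
      proof (intro nn_integral_mono)
        fix x :: "real ^ 'n"
        show "ennreal (norm x) * (h (u *\<^sub>R x) * indicator {a<..2 * a} (u * norm x) * indicator B x)
          \<le> ennreal (2 * a / u) * (h (u *\<^sub>R x) * indicator (cball 0 (2 * a)) (u *\<^sub>R x))"
        proof (cases "u * norm x \<le> 2 * a")
          case le: True
          then have "norm x \<le> 2 * a / u" using u by (simp add: field_simps)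
          then show ?thesis
            using u le by (auto simp: indicator_def B_def intro!: mult_mono ennreal_leI)
        qed simp
      qed
      also have "\<dots> = ennreal (2 * a / u) * (\<integral>\<^sup>+x. h (u *\<^sub>R x) * indicator (cball 0 (2 * a)) (u *\<^sub>R x) \<partial>lborel)"
        by (rule nn_integral_cmult) measurable
      also have "(\<integral>\<^sup>+x. h (u *\<^sub>R x) * indicator (cball 0 (2 * a)) (u *\<^sub>R x) \<partial>lborel) = ennreal (1 / u ^ n) * ?I"
      proof -
        have "?I = ennreal (u ^ n) * (\<integral>\<^sup>+x. h (u *\<^sub>R x) * indicator (cball 0 (2 * a)) (u *\<^sub>R x) \<partial>lborel)"
          using u by (subst nn_integral_lborel_affine[where c=u and t=0]) (auto simp: n_def)
        then show ?thesis
          using u by (simp add: mult.assoc[symmetric] flip: ennreal_mult'')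
      qed
      also have "ennreal (2 * a / u) * (ennreal (1 / u ^ n) * ?I) = ennreal (1 / u ^ (n + 1)) * (ennreal (2 * a) * ?I)"
        using u assms by (simp add: mult.assoc[symmetric] flip: ennreal_mult'')
      finally show ?thesis using True by simp
    next
      case False
      have "u * norm x \<le> a" if "norm x < 1" for x :: "real ^ 'n"
      proof (cases "u \<ge> 0")
        case True
        then have "u * norm x \<le> u * 1" using that by (intro mult_left_mono) auto
        then show ?thesis using False by simp
      next
        case neg: False
        then have "u * norm x \<le> 0" by (simp add: mult_nonpos_nonneg)
        then show ?thesis using assms by simp
      qed
      then have vanish: "h (u *\<^sub>R x) * indicator {a<..2 * a} (u * norm x) * indicator B x = 0" for x
        by (force simp: indicator_def B_def)
      show ?thesis unfolding vanish by simp
    qed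
  qed
  also have "\<dots> = ennreal (1 / (real n * a ^ n)) * (ennreal (2 * a) * ?I)"
    using nn_integral_inverse_power_tail[OF \<open>a > 0\<close> n] by (subst nn_integral_multc) auto
  finally have "(\<integral>\<^sup>+w. \<integral>\<^sup>+s. h (s *\<^sub>R w) * indicator {a<..2 * a} s \<partial>lborel \<partial>surf) \<le>
     ennreal (real n) * (ennreal (1 / (real n * a ^ n)) * (ennreal (2 * a) * ?I))"
    by (simp add: mult_left_mono)
  also have "\<dots> = ennreal (2 * a / a ^ n) * ?I"
    using n assms by (simp add: mult.assoc[symmetric] flip: ennreal_mult'' ennreal_mult')
  finally show ?thesis by (simp add: n_def)
qed

section \<open>Averages over directions and dyadic shells\<close>

definition shell :: "int \<Rightarrow> real set" where
  "shell k = {s. 2 powr (real_of_int k - 1) < \<bar>s\<bar> \<and> \<bar>s\<bar> \<le> 2 powr real_of_int k}"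

lemma measurable_shell [measurable]: "shell k \<in> sets borel"
  unfolding shell_def by measurable

lemma emeasure_shell: "emeasure lborel (shell k) = ennreal (2 powr real_of_int k)"
proof -
  let ?a = "2 powr (real_of_int k - 1)"
  have e: "2 powr real_of_int k = 2 * ?a" by (simp add: powr_diff)
  have "shell k = {?a<..2 * ?a} \<union> {- (2 * ?a)..<- ?a}"
    unfolding shell_def e by auto
  moreover have "emeasure lborel ({?a<..2 * ?a} \<union> {- (2 * ?a)..<- ?a}) = ennreal ?a + ennreal ?a"
    by (subst plus_emeasure[symmetric]) (auto simp: not_less intro!: order.trans[of "- ?a" 0 ?a])
  ultimately show ?thesis by (simp add: e flip: ennreal_plus)
qed

text \<open>
  The average over all directions and over one dyadic shell. The kernel \<open>F\<close> depends on the direction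
  as well as on the point, so that the weight \<open>\<bar>\<Omega> w\<bar>\<close> is a part of it and a splitting that compares
  \<open>\<bar>\<Omega> w\<bar>\<close> with a function of the point is a splitting of \<open>F\<close> into a sum.
\<close>

definition annular :: "int \<Rightarrow> (real ^ 'n \<Rightarrow> real ^ 'n \<Rightarrow> ennreal) \<Rightarrow> real ^ 'n \<Rightarrow> ennreal" where
  "annular k F x = ennreal (2 powr - real_of_int k) *
     (\<integral>\<^sup>+w. \<integral>\<^sup>+s. F w (x - s *\<^sub>R w) * indicator (shell k) s \<partial>lborel \<partial>surf)"

interpretation surf: sigma_finite_measure surf
  by (rule sigma_finite_surf)

lemma measurable_annular [measurable]:
  fixes F :: "real ^ 'n \<Rightarrow> real ^ 'n \<Rightarrow> ennreal"
  assumes [measurable]: "case_prod F \<in> borel_measurable (borel \<Otimes>\<^sub>M borel)"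
  shows "annular k F \<in> borel_measurable borel"
  unfolding annular_def by measurable

lemma annular_mono:
  fixes F F' :: "real ^ 'n \<Rightarrow> real ^ 'n \<Rightarrow> ennreal"
  assumes "\<And>w z. norm w = 1 \<Longrightarrow> norm (x - z) \<le> 2 powr real_of_int k \<Longrightarrow> F w z \<le> F' w z"
  shows "annular k F x \<le> annular k F' x"
  unfolding annular_def
proof (intro mult_left_mono nn_integral_mono_AE)
  show "AE w in surf. (\<integral>\<^sup>+s. F w (x - s *\<^sub>R w) * indicator (shell k) s \<partial>lborel)
      \<le> (\<integral>\<^sup>+s. F' w (x - s *\<^sub>R w) * indicator (shell k) s \<partial>lborel)"
    using AE_surf_norm
  proof eventually_elim
    case (elim w)
    then show ?case
      by (intro nn_integral_mono) (auto simp: indicator_def shell_def intro!: assms)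
  qed
qed simp

lemma annular_add:
  fixes F F' :: "real ^ 'n \<Rightarrow> real ^ 'n \<Rightarrow> ennreal"
  assumes [measurable]: "case_prod F \<in> borel_measurable (borel \<Otimes>\<^sub>M borel)"
    "case_prod F' \<in> borel_measurable (borel \<Otimes>\<^sub>M borel)"
  shows "annular k (\<lambda>w z. F w z + F' w z) x = annular k F x + annular k F' x"
  unfolding annular_def
  by (simp add: distrib_right nn_integral_add distrib_left)

lemma annular_cmult:
  fixes F :: "real ^ 'n \<Rightarrow> real ^ 'n \<Rightarrow> ennreal"
  assumes [measurable]: "case_prod F \<in> borel_measurable (borel \<Otimes>\<^sub>M borel)"
  shows "annular k (\<lambda>w z. c * F w z) x = c * annular k F x"
  unfolding annular_def
  by (simp add: nn_integral_cmult mult.assoc) (simp add: ac_simps)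

text \<open>
  The normalisation \<open>2^-k\<close> is the reciprocal of the length of the shell, so translation invariance
  makes the \<open>L^1\<close> bound an identity with constant one.
\<close>

lemma nn_integral_annular:
  fixes F :: "real ^ 'n \<Rightarrow> real ^ 'n \<Rightarrow> ennreal"
  assumes [measurable]: "case_prod F \<in> borel_measurable (borel \<Otimes>\<^sub>M borel)"
  shows "(\<integral>\<^sup>+x. annular k F x \<partial>lborel) = (\<integral>\<^sup>+w. \<integral>\<^sup>+z. F w z \<partial>lborel \<partial>surf)"
proof -
  have "(\<integral>\<^sup>+x. annular k F x \<partial>lborel) = ennreal (2 powr - real_of_int k) *
     (\<integral>\<^sup>+x. \<integral>\<^sup>+w. \<integral>\<^sup>+s. F w (x - s *\<^sub>R w) * indicator (shell k) s \<partial>lborel \<partial>surf \<partial>lborel)"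
    unfolding annular_def by (rule nn_integral_cmult) measurable
  also have "(\<integral>\<^sup>+x. \<integral>\<^sup>+w. \<integral>\<^sup>+s. F w (x - s *\<^sub>R w) * indicator (shell k) s \<partial>lborel \<partial>surf \<partial>lborel)
    = (\<integral>\<^sup>+w. \<integral>\<^sup>+x. \<integral>\<^sup>+s. F w (x - s *\<^sub>R w) * indicator (shell k) s \<partial>lborel \<partial>lborel \<partial>surf)"
    by (intro nn_integral_swap sigma_finite_lborel sigma_finite_surf) measurable
  also have "\<dots> = (\<integral>\<^sup>+w. \<integral>\<^sup>+s. \<integral>\<^sup>+x. F w (x - s *\<^sub>R w) * indicator (shell k) s \<partial>lborel \<partial>lborel \<partial>surf)"
    by (intro nn_integral_cong nn_integral_swap sigma_finite_lborel) measurable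
  also have "\<dots> = (\<integral>\<^sup>+w. \<integral>\<^sup>+s. (\<integral>\<^sup>+z. F w z \<partial>lborel) * indicator (shell k) s \<partial>lborel \<partial>surf)"
  proof (intro nn_integral_cong)
    fix w :: "real ^ 'n" and s :: real
    have "(\<integral>\<^sup>+z. F w z \<partial>lborel) = (\<integral>\<^sup>+x. F w (x - s *\<^sub>R w) \<partial>lborel)"
      by (subst nn_integral_lborel_affine[where c=1 and t="- (s *\<^sub>R w)"]) auto
    then show "(\<integral>\<^sup>+x. F w (x - s *\<^sub>R w) * indicator (shell k) s \<partial>lborel)
        = (\<integral>\<^sup>+z. F w z \<partial>lborel) * indicator (shell k) s"
      by (simp add: nn_integral_multc)
  qed
  also have "\<dots> = (\<integral>\<^sup>+w. (\<integral>\<^sup>+z. F w z \<partial>lborel) * ennreal (2 powr real_of_int k) \<partial>surf)"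
    by (simp add: nn_integral_cmult emeasure_shell)
  also have "\<dots> = ennreal (2 powr real_of_int k) * (\<integral>\<^sup>+w. \<integral>\<^sup>+z. F w z \<partial>lborel \<partial>surf)"
    by (subst nn_integral_multc) (auto simp: ac_simps)
  finally show ?thesis
    by (simp add: mult.assoc[symmetric] flip: ennreal_mult'' powr_add)
qed

text \<open>
  Without a weight on the directions the average is dominated by an average over a ball: on the shell
  the Jacobian \<open>\<bar>z\<bar>^(n-1)\<close> of polar coordinates is comparable to \<open>2^(k (n-1))\<close>.
\<close>

lemma annular_le_average:
  fixes h :: "real ^ 'n \<Rightarrow> ennreal"
  assumes [measurable]: "h \<in> borel_measurable borel"
  shows "annular k (\<lambda>_. h) x \<le> ennreal (2 ^ (CARD('n) + 1) * 2 powr - (real_of_int k * real CARD('n))) *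
    (\<integral>\<^sup>+z. h z * indicator (cball x (2 powr real_of_int k)) z \<partial>lborel)"
proof -
  define n where "n = CARD('n)"
  define a where "a = 2 powr (real_of_int k - 1)"
  let ?I = "\<integral>\<^sup>+z. h z * indicator (cball x (2 powr real_of_int k)) z \<partial>lborel"
  have a: "a > 0" and a2: "2 powr real_of_int k = 2 * a" by (simp_all add: a_def powr_diff)
  have [measurable]: "cball x r \<in> sets (borel :: (real ^ 'n) measure)" for x r by simp
  \<comment> \<open>The shell has a positive and a negative half, which correspond to the maps \<open>z \<mapsto> x - z\<close>
    and \<open>z \<mapsto> x + z\<close>.\<close>
  have side: "(\<integral>\<^sup>+w. \<integral>\<^sup>+s. h (x + c *\<^sub>R (s *\<^sub>R w)) * indicator {a<..2 * a} s \<partial>lborel \<partial>surf)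
     \<le> ennreal (2 * a / a ^ n) * ?I" if c: "c = 1 \<or> c = - 1" for c :: real
  proof -
    have "(\<integral>\<^sup>+w. \<integral>\<^sup>+s. h (x + c *\<^sub>R (s *\<^sub>R w)) * indicator {a<..2 * a} s \<partial>lborel \<partial>surf)
      \<le> ennreal (2 * a / a ^ n) * (\<integral>\<^sup>+z. h (x + c *\<^sub>R z) * indicator (cball 0 (2 * a)) z \<partial>lborel)"
      unfolding n_def by (intro polar_shell_bound a) measurable
    also have "(\<integral>\<^sup>+z. h (x + c *\<^sub>R z) * indicator (cball 0 (2 * a)) z \<partial>lborel) = ?I"
      using c by (subst (2) nn_integral_lborel_affine[where c=c and t=x])
        (auto simp: a2 dist_norm indicator_def)
    finally show ?thesis .
  qed
  have "(\<integral>\<^sup>+w. \<integral>\<^sup>+s. h (x - s *\<^sub>R w) * indicator (shell k) s \<partial>lborel \<partial>surf) \<le>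
     (\<integral>\<^sup>+w. (\<integral>\<^sup>+s. h (x + (-1) *\<^sub>R (s *\<^sub>R w)) * indicator {a<..2 * a} s \<partial>lborel) +
            (\<integral>\<^sup>+s. h (x + 1 *\<^sub>R (s *\<^sub>R w)) * indicator {a<..2 * a} s \<partial>lborel) \<partial>surf)"
  proof (intro nn_integral_mono)
    fix w :: "real ^ 'n"
    have "(\<integral>\<^sup>+s. h (x - s *\<^sub>R w) * indicator (shell k) s \<partial>lborel) =
      (\<integral>\<^sup>+s. h (x + (-1) *\<^sub>R (s *\<^sub>R w)) * indicator {a<..2 * a} s + h (x - s *\<^sub>R w) * indicator {a<..2 * a} (- s) \<partial>lborel)"
      using a by (intro nn_integral_cong) (auto simp: shell_def indicator_def a2 a_def[symmetric])
    also have "\<dots> = (\<integral>\<^sup>+s. h (x + (-1) *\<^sub>R (s *\<^sub>R w)) * indicator {a<..2 * a} s \<partial>lborel) +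
        (\<integral>\<^sup>+s. h (x - s *\<^sub>R w) * indicator {a<..2 * a} (- s) \<partial>lborel)"
      by (intro nn_integral_add) measurable
    also have "(\<integral>\<^sup>+s. h (x - s *\<^sub>R w) * indicator {a<..2 * a} (- s) \<partial>lborel)
      = (\<integral>\<^sup>+s. h (x + 1 *\<^sub>R (s *\<^sub>R w)) * indicator {a<..2 * a} s \<partial>lborel)"
      by (subst nn_integral_real_affine[where c="-1" and t=0]) auto
    finally show "(\<integral>\<^sup>+s. h (x - s *\<^sub>R w) * indicator (shell k) s \<partial>lborel) \<le>
      (\<integral>\<^sup>+s. h (x + (-1) *\<^sub>R (s *\<^sub>R w)) * indicator {a<..2 * a} s \<partial>lborel) +
            (\<integral>\<^sup>+s. h (x + 1 *\<^sub>R (s *\<^sub>R w)) * indicator {a<..2 * a} s \<partial>lborel)" by simp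
  qed
  also have "\<dots> = (\<integral>\<^sup>+w. (\<integral>\<^sup>+s. h (x + (-1) *\<^sub>R (s *\<^sub>R w)) * indicator {a<..2 * a} s \<partial>lborel) \<partial>surf) +
            (\<integral>\<^sup>+w. (\<integral>\<^sup>+s. h (x + 1 *\<^sub>R (s *\<^sub>R w)) * indicator {a<..2 * a} s \<partial>lborel) \<partial>surf)"
    by (intro nn_integral_add) measurable
  also have "\<dots> \<le> ennreal (2 * a / a ^ n) * ?I + ennreal (2 * a / a ^ n) * ?I"
    by (intro add_mono side) auto
  also have "\<dots> = ennreal (4 * a / a ^ n) * ?I"
    using a by (simp add: distrib_right[symmetric] flip: ennreal_plus)
  finally have "annular k (\<lambda>_. h) x \<le> ennreal (2 powr - real_of_int k) * (ennreal (4 * a / a ^ n) * ?I)"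
    unfolding annular_def by (intro mult_left_mono) auto
  also have "\<dots> = ennreal (2 powr - real_of_int k * (4 * a / a ^ n)) * ?I"
    using a by (simp add: mult.assoc[symmetric] flip: ennreal_mult'')
  also have "2 powr - real_of_int k * (4 * a / a ^ n) = 2 ^ (n + 1) * 2 powr - (real_of_int k * real n)"
  proof -
    have "a ^ n = 2 powr ((real_of_int k - 1) * real n)"
      by (simp add: a_def powr_powr flip: powr_realpow)
    also have "\<dots> = 2 powr (real_of_int k * real n) / 2 ^ n"
      by (simp add: left_diff_distrib powr_diff powr_realpow)
    finally have "a ^ n = 2 powr (real_of_int k * real n) / 2 ^ n" .
    then show ?thesis
      using a by (simp add: powr_minus a2 field_simps)
  qed
  finally show ?thesis by (simp add: n_def)
qed

section \<open>Dyadic cubes\<close>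

text \<open>
  The half-open dyadic cube of side \<open>2^k\<close> that contains \<open>z\<close>. Addressing a cube by a point that it contains
  makes it a jointly measurable relation, so that sums over cubes can be written as integrals.
\<close>

definition cell :: "int \<Rightarrow> real ^ 'n \<Rightarrow> (real ^ 'n) set" where
  "cell k z = {y. \<forall>i. \<lfloor>y $ i / 2 powr real_of_int k\<rfloor> = \<lfloor>z $ i / 2 powr real_of_int k\<rfloor>}"

lemma cell_eq: "y \<in> cell k z \<Longrightarrow> cell k y = cell k z"
  by (auto simp: cell_def)

lemma cell_sym: "y \<in> cell k z \<longleftrightarrow> z \<in> cell k y"
  by (auto simp: cell_def)

lemma cell_subset_parent: "cell k z \<subseteq> cell (k + 1) z"
proof -
  have half: "\<lfloor>t / 2 powr real_of_int (k + 1)\<rfloor> = \<lfloor>t / 2 powr real_of_int k\<rfloor> div 2" for t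
  proof -
    have "\<lfloor>x / 2\<rfloor> = \<lfloor>x\<rfloor> div 2" for x :: real
      by linarith
    from this[of "t / 2 powr real_of_int k"] show ?thesis
      by (simp add: powr_add)
  qed
  show ?thesis
    unfolding cell_def half by auto
qed

lemma cell_mono:
  assumes "j \<le> k"
  shows "cell j z \<subseteq> cell k z"
  using assms
proof (induction k rule: int_ge_induct)
  case (step i)
  then show ?case using cell_subset_parent by blast
qed simp

lemma pred_cell [measurable]:
  "Measurable.pred (borel \<Otimes>\<^sub>M borel) (\<lambda>p. fst p \<in> cell k (snd p :: real ^ 'n))"
proof -
  have [measurable]: "(\<lambda>p. fst p $ i) \<in> borel_measurable (borel \<Otimes>\<^sub>M borel)"
      "(\<lambda>p. snd p $ i) \<in> borel_measurable (borel \<Otimes>\<^sub>M borel)"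
    for i :: 'n
    by (intro borel_measurable_continuous_onI continuous_intros
        measurable_compose[OF measurable_fst] measurable_compose[OF measurable_snd])+
  have [measurable]: "(\<lambda>p. \<lfloor>fst p $ i / 2 powr real_of_int k\<rfloor>) \<in> borel \<Otimes>\<^sub>M borel \<rightarrow>\<^sub>M count_space UNIV"
      "(\<lambda>p. \<lfloor>snd p $ i / 2 powr real_of_int k\<rfloor>) \<in> borel \<Otimes>\<^sub>M borel \<rightarrow>\<^sub>M count_space UNIV"
    for i :: 'n
    by measurable
  show ?thesis
    unfolding cell_def mem_Collect_eq by measurable
qed

lemma measurable_cell [measurable]: "cell k z \<in> sets borel"
  unfolding cell_def by measurable

lemma emeasure_cell:
  "emeasure lborel (cell k (z :: real ^ 'n)) = ennreal (2 powr (real_of_int k * real CARD('n)))"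
proof -
  let ?d = "2 powr real_of_int k"
  define a where "a = (\<chi> i. real_of_int \<lfloor>z $ i / ?d\<rfloor> * ?d)"
  define b where "b = (\<chi> i. a $ i + ?d)"
  have mem: "y \<in> cell k z \<longleftrightarrow> (\<forall>i. a $ i \<le> y $ i \<and> y $ i < b $ i)" for y
    by (auto simp: cell_def a_def b_def floor_eq_iff field_simps)
  have vol: "emeasure lborel (cbox a b) = ennreal (2 powr (real_of_int k * real CARD('n)))"
  proof -
    have "cbox a b \<noteq> {}"
      by (simp add: b_def interval_ne_empty_cart)
    then have "measure lborel (cbox a b) = ?d ^ CARD('n)"
      by (simp add: content_cbox_cart b_def)
    moreover have "?d ^ CARD('n) = 2 powr (real_of_int k * real CARD('n))"
      by (simp add: powr_powr flip: powr_realpow)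
    moreover have "emeasure lborel (cbox a b) = ennreal (measure lborel (cbox a b))"
      by (rule emeasure_eq_ennreal_measure) (metis emeasure_lborel_cbox_finite infinity_ennreal_def less_irrefl)
    ultimately show ?thesis by simp
  qed
  have "box a b \<subseteq> cell k z" "cell k z \<subseteq> cbox a b"
    by (auto simp: mem mem_box_cart less_imp_le)
  then have "emeasure lborel (box a b) \<le> emeasure lborel (cell k z)"
     "emeasure lborel (cell k z) \<le> emeasure lborel (cbox a b)"
    by (auto intro!: emeasure_mono)
  moreover have "emeasure lborel (box a b) = emeasure lborel (cbox a b)"
    by (simp add: emeasure_lborel_box_eq emeasure_lborel_cbox_eq)
  ultimately show ?thesis using vol by simp
qed

definition mass :: "(real ^ 'n \<Rightarrow> ennreal) \<Rightarrow> int \<Rightarrow> real ^ 'n \<Rightarrow> ennreal" where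
  "mass f k z = (\<integral>\<^sup>+y. f y * indicator (cell k z) y \<partial>lborel)"

lemma measurable_mass [measurable]:
  fixes f :: "real ^ 'n \<Rightarrow> ennreal"
  assumes [measurable]: "f \<in> borel_measurable borel"
  shows "mass f k \<in> borel_measurable borel"
proof -
  have "(\<lambda>z. \<integral>\<^sup>+y. f y * indicator {p. fst p \<in> cell k (snd p)} (y, z) \<partial>lborel) \<in> borel_measurable borel"
    by measurable
  then show ?thesis by (simp add: mass_def[abs_def] indicator_def)
qed

lemma mass_cell: "y \<in> cell k z \<Longrightarrow> mass f k y = mass f k z"
  by (simp add: mass_def cell_eq)

lemma mass_mono: "j \<le> k \<Longrightarrow> mass f j z \<le> mass f k z"
  unfolding mass_def using cell_mono[of j k z]
  by (intro nn_integral_mono) (auto simp: indicator_def)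

lemma mass_le: "mass f k z \<le> (\<integral>\<^sup>+y. f y \<partial>lborel)"
  unfolding mass_def by (intro nn_integral_mono) (auto simp: indicator_def)

text \<open>
  This identity replaces sums over dyadic cubes: a function that is constant on the cubes is paired
  with \<open>f\<close> in the same way as with the cubewise average of \<open>f\<close>. It holds because \<open>y \<in> cell k z\<close> is symmetric
  in \<open>y\<close> and \<open>z\<close> and all cubes have the same volume.
\<close>

lemma nn_integral_mult_mass:
  fixes f h :: "real ^ 'n \<Rightarrow> ennreal"
  assumes [measurable]: "f \<in> borel_measurable borel" "h \<in> borel_measurable borel"
    and const: "\<And>y z. y \<in> cell k z \<Longrightarrow> h y = h z"
  shows "(\<integral>\<^sup>+z. h z * mass f k z \<partial>lborel) =
    ennreal (2 powr (real_of_int k * real CARD('n))) * (\<integral>\<^sup>+z. h z * f z \<partial>lborel)"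
proof -
  let ?P = "{p :: (real ^ 'n) \<times> (real ^ 'n). fst p \<in> cell k (snd p)}"
  have [measurable]: "?P \<in> sets (borel \<Otimes>\<^sub>M borel)"
    using pred_cell by (simp add: pred_def space_pair_measure)
  have "(\<integral>\<^sup>+z. h z * mass f k z \<partial>lborel) = (\<integral>\<^sup>+z. \<integral>\<^sup>+y. h z * (f y * indicator ?P (y, z)) \<partial>lborel \<partial>lborel)"
    unfolding mass_def by (intro nn_integral_cong, subst nn_integral_cmult) (auto simp: indicator_def)
  also have "\<dots> = (\<integral>\<^sup>+y. \<integral>\<^sup>+z. h z * (f y * indicator ?P (y, z)) \<partial>lborel \<partial>lborel)"
    by (intro nn_integral_swap sigma_finite_lborel) measurable
  also have "\<dots> = (\<integral>\<^sup>+y. \<integral>\<^sup>+z. h y * f y * indicator (cell k y) z \<partial>lborel \<partial>lborel)"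
    using const by (intro nn_integral_cong) (auto simp: indicator_def cell_sym mult.assoc)
  also have "\<dots> = ennreal (2 powr (real_of_int k * real CARD('n))) * (\<integral>\<^sup>+z. h z * f z \<partial>lborel)"
    by (simp add: emeasure_cell nn_integral_cmult nn_integral_multc mult.commute)
  finally show ?thesis .
qed

text \<open>
  The offsets, in units of the side length, from a dyadic cube to itself and to the cubes that touch it.
\<close>

definition neighbour_offsets :: "(real ^ 'n) set" where
  "neighbour_offsets = {e. \<forall>i. e $ i \<in> {-1, 0, 1}}"

lemma finite_neighbour_offsets: "finite (neighbour_offsets :: (real ^ 'n) set)"
proof -
  have "neighbour_offsets = vec_lambda ` (PiE (UNIV :: 'n set) (\<lambda>_. {-1, 0, 1 :: real}))"
  proof (intro equalityI subsetI)
    fix e :: "real ^ 'n" assume "e \<in> neighbour_offsets"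
    then have "vec_nth e \<in> PiE (UNIV :: 'n set) (\<lambda>_. {-1, 0, 1})" "e = vec_lambda (vec_nth e)"
      by (auto simp: neighbour_offsets_def)
    then show "e \<in> vec_lambda ` (PiE (UNIV :: 'n set) (\<lambda>_. {-1, 0, 1 :: real}))" by blast
  qed (auto simp: neighbour_offsets_def PiE_def Pi_def)
  moreover have "finite (PiE (UNIV :: 'n set) (\<lambda>_. {-1, 0, 1 :: real}))"
    by (intro finite_PiE) auto
  ultimately show ?thesis by (metis finite_imageI)
qed

lemma zero_in_neighbour_offsets: "0 \<in> neighbour_offsets"
  by (simp add: neighbour_offsets_def)

lemma near_in_neighbour_cell:
  fixes x z :: "real ^ 'n"
  assumes "norm (x - z) \<le> 2 powr real_of_int k"
  obtains e where "e \<in> neighbour_offsets" "z \<in> cell k (x + 2 powr real_of_int k *\<^sub>R e)"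
proof
  let ?d = "2 powr real_of_int k"
  define e :: "real ^ 'n" where "e = (\<chi> i. real_of_int (\<lfloor>z $ i / ?d\<rfloor> - \<lfloor>x $ i / ?d\<rfloor>))"
  have "\<lfloor>z $ i / ?d\<rfloor> - \<lfloor>x $ i / ?d\<rfloor> \<in> {-1, 0, 1}" for i
  proof -
    have "\<bar>x $ i - z $ i\<bar> \<le> ?d"
      using component_le_norm_cart[of "x - z" i] assms by simp
    then have "\<bar>x $ i / ?d - z $ i / ?d\<bar> \<le> 1"
      by (simp add: field_simps flip: diff_divide_distrib)
    then have "\<lfloor>z $ i / ?d\<rfloor> - \<lfloor>x $ i / ?d\<rfloor> \<le> 1" "\<lfloor>z $ i / ?d\<rfloor> - \<lfloor>x $ i / ?d\<rfloor> \<ge> -1"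
      by linarith+
    then show ?thesis by auto
  qed
  then show "e \<in> neighbour_offsets"
    by (force simp: neighbour_offsets_def e_def)
  have "(x + ?d *\<^sub>R e) $ i / ?d = x $ i / ?d + real_of_int (\<lfloor>z $ i / ?d\<rfloor> - \<lfloor>x $ i / ?d\<rfloor>)" for i
    by (simp add: e_def add_divide_distrib)
  then show "z \<in> cell k (x + ?d *\<^sub>R e)"
    unfolding cell_def by (simp only: floor_add_int[symmetric]) simp
qed

section \<open>A weak-type bound from exceptional sets and weights\<close>

lemma emeasure_translation_vimage:
  fixes v :: "'a::euclidean_space"
  assumes [measurable]: "G \<in> sets borel"
  shows "emeasure lborel {x. x + v \<in> G} = emeasure lborel G"
proof -
  have "emeasure lborel G = (\<integral>\<^sup>+x. indicator G x \<partial>lborel)"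
    by simp
  also have "\<dots> = (\<integral>\<^sup>+x. indicator G (v + x) \<partial>lborel)"
    by (subst nn_integral_lborel_affine[where c=1 and t=v]) simp_all
  also have "(\<lambda>x. indicator G (v + x)) = (indicator {x. x + v \<in> G} :: 'a \<Rightarrow> ennreal)"
    by (auto simp: indicator_def add.commute fun_eq_iff)
  also have "(\<integral>\<^sup>+x. indicator {x. x + v \<in> G} x \<partial>lborel) = emeasure lborel {x. x + v \<in> G}"
    by (rule nn_integral_indicator) measurable
  finally show ?thesis by (rule sym)
qed

text \<open>
  Counts the scales at which a geometrically growing weight stays below \<open>a\<close>: they lie within a distance
  of \<open>log a / (\<delta> log 2)\<close> from each other. The logarithm in the \<open>L log L\<close> norm comes from here.
\<close>

lemma emeasure_count_geometric_range:
  fixes K :: "int set"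
  assumes "\<delta> > 0"
    and K: "\<And>i j. i \<in> K \<Longrightarrow> j \<in> K \<Longrightarrow> i \<le> j \<Longrightarrow> 2 powr (\<delta> * real_of_int (j - i)) < a"
  shows "emeasure (count_space UNIV) K \<le> ennreal ((1 + 1 / (\<delta> * ln 2)) * (1 + log_plus a))"
proof (cases "K = {}")
  case False
  define b where "b = ln a / (\<delta> * ln 2)"
  obtain k1 where k1: "k1 \<in> K" using False by blast
  have a: "a > 1" using K[OF k1 k1] by simp
  have close: "real_of_int (j - i) \<le> b" if "i \<in> K" "j \<in> K" "i \<le> j" for i j
  proof -
    have "ln (2 powr (\<delta> * real_of_int (j - i))) < ln a"
      using K[OF that] a by (subst ln_less_cancel_iff) auto
    then show ?thesis
      using assms(1) by (simp add: ln_powr b_def field_simps)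
  qed
  have "K \<subseteq> {k1 - \<lceil>b\<rceil>..k1 + \<lceil>b\<rceil>}"
  proof
    fix k assume "k \<in> K"
    then show "k \<in> {k1 - \<lceil>b\<rceil>..k1 + \<lceil>b\<rceil>}"
      using close[OF k1, of k] close[OF _ k1, of k] by (cases "k \<le> k1") (auto, linarith+)
  qed
  then have fin: "finite K" by (rule finite_subset) simp
  have "K \<subseteq> {Min K..Max K}" using fin by auto
  then have "card K \<le> card {Min K..Max K}" by (intro card_mono) auto
  then have "real (card K) \<le> real_of_int (Max K - Min K) + 1"
    using Min_le[OF fin Max_in[OF fin False]] by simp
  also have "\<dots> \<le> b + 1"
    using close[of "Min K" "Max K"] fin False by simp
  also have "\<dots> \<le> (1 + 1 / (\<delta> * ln 2)) * (1 + log_plus a)"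
    using a assms(1) by (simp add: b_def log_plus_def field_simps)
  finally show ?thesis
    using fin by (simp add: ennreal_of_nat_eq_real_of_nat ennreal_leI)
qed simp

lemma nn_integral_near_le:
  fixes h :: "real ^ 'n \<Rightarrow> ennreal"
  assumes [measurable]: "h \<in> borel_measurable borel"
    and bound: "\<And>e. e \<in> neighbour_offsets \<Longrightarrow> mass h k (x + 2 powr real_of_int k *\<^sub>R e) \<le> c"
  shows "(\<integral>\<^sup>+z. h z * indicator (cball x (2 powr real_of_int k)) z \<partial>lborel)
    \<le> of_nat (card (neighbour_offsets :: (real ^ 'n) set)) * c"
proof -
  let ?N = "neighbour_offsets :: (real ^ 'n) set"
  have "(\<integral>\<^sup>+z. h z * indicator (cball x (2 powr real_of_int k)) z \<partial>lborel)
    \<le> (\<integral>\<^sup>+z. (\<Sum>e\<in>?N. h z * indicator (cell k (x + 2 powr real_of_int k *\<^sub>R e)) z) \<partial>lborel)"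
  proof (intro nn_integral_mono)
    fix z
    show "h z * indicator (cball x (2 powr real_of_int k)) z
      \<le> (\<Sum>e\<in>?N. h z * indicator (cell k (x + 2 powr real_of_int k *\<^sub>R e)) z)"
    proof (cases "z \<in> cball x (2 powr real_of_int k)")
      case True
      then have "norm (x - z) \<le> 2 powr real_of_int k" by (simp add: dist_norm)
      then obtain e where e: "e \<in> ?N" "z \<in> cell k (x + 2 powr real_of_int k *\<^sub>R e)"
        by (rule near_in_neighbour_cell)
      then have "h z * indicator (cball x (2 powr real_of_int k)) z
          = h z * indicator (cell k (x + 2 powr real_of_int k *\<^sub>R e)) z"
        using True by simp
      also have "\<dots> \<le> (\<Sum>e\<in>?N. h z * indicator (cell k (x + 2 powr real_of_int k *\<^sub>R e)) z)"
        using e finite_neighbour_offsets by (intro member_le_sum) auto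
      finally show ?thesis .
    qed simp
  qed
  also have "\<dots> = (\<Sum>e\<in>?N. mass h k (x + 2 powr real_of_int k *\<^sub>R e))"
    unfolding mass_def by (rule nn_integral_sum) measurable
  also have "\<dots> \<le> (\<Sum>e\<in>?N. c)"
    by (intro sum_mono bound)
  finally show ?thesis by simp
qed

text \<open>
  The discrete form of the left-hand side of the weak-type inequality: up to a constant, \<open>2^(\<gamma> k)\<close> is the integral
  of \<open>t^(\<gamma> - 1)\<close> over the dyadic interval of \<open>t\<close> of length \<open>2^k\<close>.
\<close>

definition level_sum :: "real \<Rightarrow> (real ^ 'n \<Rightarrow> real) \<Rightarrow> (real ^ 'n \<Rightarrow> ennreal) \<Rightarrow> real \<Rightarrow> ennreal" where
  "level_sum \<gamma> W f \<mu> = (\<integral>\<^sup>+k. ennreal (2 powr (\<gamma> * real_of_int k)) *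
     emeasure lborel {x. annular k (\<lambda>u z. ennreal (W u) * f z) x > ennreal (\<mu> * 2 powr (\<gamma> * real_of_int k))}
     \<partial>count_space UNIV)"

text \<open>
  The hypotheses say that the exceptional sets are small (\<open>small\<close>), that the weights are small enough
  for \<open>w_k * f\<close> to have density at most \<open>Cb * 2^(\<gamma> k)\<close> on the cubes outside \<open>G k\<close> (\<open>density\<close>), and that they are
  large enough to separate the scales (\<open>growth\<close>). The maximum appears in \<open>growth\<close> because it is applied to
  two scales whose weights both lie below \<open>W u\<close>; this bounds their distance, whether the weights
  increase or decrease with the scale.
  
  The level \<open>C0\<close> is twice the pointwise bound for the part of the average where the weight exceeds
  \<open>W u\<close>, so that on the level set the other part carries at least half of the level and Chebyshev's
  inequality applies to it.
\<close>

lemma weak_type_of_weights: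
  fixes f :: "real ^ 'n \<Rightarrow> ennreal" and W :: "real ^ 'n \<Rightarrow> real"
    and G :: "int \<Rightarrow> (real ^ 'n) set" and w :: "int \<Rightarrow> real ^ 'n \<Rightarrow> ennreal"
  defines "N \<equiv> card (neighbour_offsets :: (real ^ 'n) set)"
  defines "C0 \<equiv> \<lambda>Cb. 2 * (2 ^ (CARD('n) + 1) * real N * Cb)"
  assumes f [measurable]: "f \<in> borel_measurable borel"
    and W [measurable]: "W \<in> borel_measurable borel"
    and G [measurable]: "\<And>k. G k \<in> sets borel"
    and w [measurable]: "\<And>k. w k \<in> borel_measurable borel"
    and const: "\<And>k y z. y \<in> cell k z \<Longrightarrow> z \<in> G k \<Longrightarrow> y \<in> G k"
    and pos: "Ca \<ge> 0" "Cb > 0" "\<delta> > 0"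
    and small: "(\<integral>\<^sup>+k. ennreal (2 powr (\<gamma> * real_of_int k)) * emeasure lborel (G k) \<partial>count_space UNIV)
      \<le> ennreal Ca * (\<integral>\<^sup>+z. f z \<partial>lborel)"
    and density: "\<And>k z. z \<notin> G k \<Longrightarrow> mass (\<lambda>y. w k y * f y) k z
      \<le> ennreal (Cb * 2 powr (real_of_int k * (\<gamma> + real CARD('n))))"
    and growth: "\<And>j k z. j \<le> k \<Longrightarrow> z \<notin> G j \<Longrightarrow> z \<notin> G k \<Longrightarrow>
      ennreal (2 powr (\<delta> * real_of_int (k - j))) \<le> max (w j z) (w k z)"
  shows "level_sum \<gamma> W f (C0 Cb)
    \<le> ennreal (real N * Ca + 2 / C0 Cb * (1 + 1 / (\<delta> * ln 2))) *
       (1 + (\<integral>\<^sup>+u. ennreal (W u * (1 + log_plus (W u))) \<partial>surf)) * (\<integral>\<^sup>+z. f z \<partial>lborel)"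
proof -
  let ?\<sigma> = "surf :: (real ^ 'n) measure"
  define I where "I = (\<integral>\<^sup>+z. f z \<partial>lborel)"
  define L where "L = (\<integral>\<^sup>+u. ennreal (W u * (1 + log_plus (W u))) \<partial>?\<sigma>)"
  define c where "c = 1 + 1 / (\<delta> * ln 2)"
  define q where "q k = C0 Cb / 2 * 2 powr (\<gamma> * real_of_int k)" for k
  define V where "V k = {x. \<exists>e\<in>neighbour_offsets. x + 2 powr real_of_int k *\<^sub>R e \<in> G k}" for k
  define bad where "bad k u z = (if z \<notin> G k \<and> w k z < ennreal (W u) then ennreal (W u) * f z else 0)" for k u z
  have [measurable]: "(\<lambda>p. bad k (fst p) (snd p)) \<in> borel_measurable (borel \<Otimes>\<^sub>M borel)" for k
    unfolding bad_def by measurable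
  have [measurable]: "case_prod (bad k) \<in> borel_measurable (borel \<Otimes>\<^sub>M borel)" for k
    by (simp add: case_prod_beta')
  have [measurable]: "log_plus \<in> borel_measurable borel"
    unfolding log_plus_def by measurable
  have N: "N > 0"
    unfolding N_def using finite_neighbour_offsets zero_in_neighbour_offsets by (auto simp: card_gt_0_iff)
  have C0: "C0 Cb > 0" using N pos by (simp add: C0_def)
  have q: "q k > 0" for k using C0 by (simp add: q_def)
  have c: "c \<ge> 0" using pos by (simp add: c_def)
  have V_eq: "V k = (\<Union>e\<in>neighbour_offsets. {x. x + 2 powr real_of_int k *\<^sub>R e \<in> G k})" for k
    by (auto simp: V_def)
  have V_meas [measurable]: "V k \<in> sets borel" for k
    unfolding V_eq by (intro sets.finite_UN finite_neighbour_offsets) measurable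
  have V_le: "emeasure lborel (V k) \<le> of_nat N * emeasure lborel (G k)" for k
  proof -
    have "emeasure lborel (V k) \<le> (\<Sum>e\<in>neighbour_offsets. emeasure lborel {x. x + 2 powr real_of_int k *\<^sub>R e \<in> G k})"
      unfolding V_eq by (intro emeasure_subadditive_finite finite_neighbour_offsets) auto
    then show ?thesis by (simp add: emeasure_translation_vimage N_def)
  qed
  \<comment> \<open>Away from the neighbours of \<open>G k\<close>, the points \<open>z\<close> that are seen from \<open>x\<close> at scale \<open>k\<close> lie in cubes outside
    \<open>G k\<close>. Where \<open>W u \<le> w k z\<close> the kernel is at most \<open>w k z * f z\<close>, and \<open>bad\<close> contains all the rest.\<close>
  have split: "annular k (\<lambda>u z. ennreal (W u) * f z) x \<le> ennreal (q k) + annular k (bad k) x"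
    if "x \<notin> V k" for k x
  proof -
    have notG: "x + 2 powr real_of_int k *\<^sub>R e \<notin> G k" if "e \<in> neighbour_offsets" for e
      using \<open>x \<notin> V k\<close> that by (auto simp: V_def)
    have "annular k (\<lambda>u z. ennreal (W u) * f z) x \<le> annular k (\<lambda>u z. w k z * f z + bad k u z) x"
    proof (rule annular_mono)
      fix u z assume "norm (x - z) \<le> 2 powr real_of_int k"
      then obtain e where "e \<in> neighbour_offsets" "z \<in> cell k (x + 2 powr real_of_int k *\<^sub>R e)"
        by (rule near_in_neighbour_cell)
      then have "z \<notin> G k" using notG const cell_sym by blast
      then show "ennreal (W u) * f z \<le> w k z * f z + bad k u z"
        by (auto simp: bad_def not_less intro!: mult_right_mono)
    qed
    also have "\<dots> = annular k (\<lambda>u z. w k z * f z) x + annular k (bad k) x"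
      by (rule annular_add) measurable
    also have "annular k (\<lambda>u z. w k z * f z) x \<le> ennreal (2 ^ (CARD('n) + 1) * 2 powr - (real_of_int k * real CARD('n))) *
      (\<integral>\<^sup>+z. (w k z * f z) * indicator (cball x (2 powr real_of_int k)) z \<partial>lborel)"
      by (rule annular_le_average) measurable
    also have "(\<integral>\<^sup>+z. (w k z * f z) * indicator (cball x (2 powr real_of_int k)) z \<partial>lborel) \<le>
      of_nat N * ennreal (Cb * 2 powr (real_of_int k * (\<gamma> + real CARD('n))))"
      unfolding N_def by (intro nn_integral_near_le density notG) measurable
    also have "ennreal (2 ^ (CARD('n) + 1) * 2 powr - (real_of_int k * real CARD('n))) *
      (of_nat N * ennreal (Cb * 2 powr (real_of_int k * (\<gamma> + real CARD('n))))) = ennreal (q k)"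
      using pos by (simp add: q_def C0_def ennreal_of_nat_eq_real_of_nat ring_distribs powr_add powr_minus mult.commute
          flip: ennreal_mult'' ennreal_mult')
    finally show ?thesis by (simp add: mult_left_mono add_right_mono)
  qed
  have level: "emeasure lborel {x. annular k (\<lambda>u z. ennreal (W u) * f z) x > ennreal (C0 Cb * 2 powr (\<gamma> * real_of_int k))}
    \<le> of_nat N * emeasure lborel (G k) + ennreal (1 / q k) * (\<integral>\<^sup>+u. \<integral>\<^sup>+z. bad k u z \<partial>lborel \<partial>?\<sigma>)" for k
  proof -
    let ?M = "{x \<in> UNIV. 1 \<le> ennreal (1 / q k) * annular k (bad k) x}"
    have qq: "ennreal (C0 Cb * 2 powr (\<gamma> * real_of_int k)) = ennreal (q k) + ennreal (q k)"
      using q[of k] by (simp add: q_def flip: ennreal_plus)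
    have "{x. annular k (\<lambda>u z. ennreal (W u) * f z) x > ennreal (C0 Cb * 2 powr (\<gamma> * real_of_int k))} \<subseteq> V k \<union> ?M"
    proof
      fix x assume "x \<in> {x. annular k (\<lambda>u z. ennreal (W u) * f z) x > ennreal (C0 Cb * 2 powr (\<gamma> * real_of_int k))}"
      then have big: "ennreal (q k) + ennreal (q k) < annular k (\<lambda>u z. ennreal (W u) * f z) x"
        unfolding qq by simp
      show "x \<in> V k \<union> ?M"
      proof (cases "x \<in> V k")
        case False
        have "ennreal (q k) \<le> annular k (bad k) x"
        proof (rule ccontr)
          assume "\<not> ennreal (q k) \<le> annular k (bad k) x"
          then have "ennreal (q k) + annular k (bad k) x \<le> ennreal (q k) + ennreal (q k)"
            by (intro add_left_mono) simp
          with split[OF False] big show False by (meson leD order_trans)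
        qed
        then have "ennreal (1 / q k) * ennreal (q k) \<le> ennreal (1 / q k) * annular k (bad k) x"
          by (intro mult_left_mono) auto
        then show ?thesis using q[of k] by (simp flip: ennreal_mult'')
      qed simp
    qed
    then have "emeasure lborel {x. annular k (\<lambda>u z. ennreal (W u) * f z) x > ennreal (C0 Cb * 2 powr (\<gamma> * real_of_int k))}
      \<le> emeasure lborel (V k \<union> ?M)"
      by (intro emeasure_mono) auto
    also have "\<dots> \<le> emeasure lborel (V k) + emeasure lborel ?M"
      by (intro emeasure_subadditive) auto
    also have "emeasure lborel ?M \<le> ennreal (1 / q k) * (\<integral>\<^sup>+x. annular k (bad k) x * indicator UNIV x \<partial>lborel)"
      by (rule nn_integral_Markov_inequality) auto
    also have "(\<integral>\<^sup>+x. annular k (bad k) x * indicator UNIV x \<partial>lborel) = (\<integral>\<^sup>+u. \<integral>\<^sup>+z. bad k u z \<partial>lborel \<partial>?\<sigma>)"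
      by (simp add: nn_integral_annular)
    finally show ?thesis
      using V_le[of k] by (meson add_mono order_refl order_trans)
  qed
  have "level_sum \<gamma> W f (C0 Cb)
    \<le> (\<integral>\<^sup>+k. of_nat N * (ennreal (2 powr (\<gamma> * real_of_int k)) * emeasure lborel (G k)) +
         ennreal (2 / C0 Cb) * (\<integral>\<^sup>+u. \<integral>\<^sup>+z. bad k u z \<partial>lborel \<partial>?\<sigma>) \<partial>count_space UNIV)"
    unfolding level_sum_def
  proof (intro nn_integral_mono)
    fix k :: int
    have "2 powr (\<gamma> * real_of_int k) * (1 / q k) = 2 / C0 Cb"
      using C0 by (simp add: q_def)
    then have "ennreal (2 powr (\<gamma> * real_of_int k)) * ennreal (1 / q k) = ennreal (2 / C0 Cb)"
      by (metis ennreal_mult' powr_ge_zero)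
    then have "ennreal (2 powr (\<gamma> * real_of_int k)) * (of_nat N * emeasure lborel (G k) +
          ennreal (1 / q k) * (\<integral>\<^sup>+u. \<integral>\<^sup>+z. bad k u z \<partial>lborel \<partial>?\<sigma>)) =
        of_nat N * (ennreal (2 powr (\<gamma> * real_of_int k)) * emeasure lborel (G k)) +
         ennreal (2 / C0 Cb) * (\<integral>\<^sup>+u. \<integral>\<^sup>+z. bad k u z \<partial>lborel \<partial>?\<sigma>)"
      by (simp add: distrib_left mult.assoc[symmetric]) (simp add: ac_simps)
    then show "ennreal (2 powr (\<gamma> * real_of_int k)) *
       emeasure lborel {x. annular k (\<lambda>u z. ennreal (W u) * f z) x > ennreal (C0 Cb * 2 powr (\<gamma> * real_of_int k))}
      \<le> of_nat N * (ennreal (2 powr (\<gamma> * real_of_int k)) * emeasure lborel (G k)) +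
         ennreal (2 / C0 Cb) * (\<integral>\<^sup>+u. \<integral>\<^sup>+z. bad k u z \<partial>lborel \<partial>?\<sigma>)"
      by (metis level mult_left_mono zero_le)
  qed
  also have "\<dots> = of_nat N * (\<integral>\<^sup>+k. ennreal (2 powr (\<gamma> * real_of_int k)) * emeasure lborel (G k) \<partial>count_space UNIV)
      + ennreal (2 / C0 Cb) * (\<integral>\<^sup>+k. \<integral>\<^sup>+u. \<integral>\<^sup>+z. bad k u z \<partial>lborel \<partial>?\<sigma> \<partial>count_space UNIV)"
    by (simp add: nn_integral_add nn_integral_cmult)
  also have "(\<integral>\<^sup>+k. \<integral>\<^sup>+u. \<integral>\<^sup>+z. bad k u z \<partial>lborel \<partial>?\<sigma> \<partial>count_space UNIV)
      = (\<integral>\<^sup>+u. \<integral>\<^sup>+k. \<integral>\<^sup>+z. bad k u z \<partial>lborel \<partial>count_space UNIV \<partial>?\<sigma>)"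
    by (rule nn_integral_count_space_nn_integral[symmetric]) auto
  also have "\<dots> = (\<integral>\<^sup>+u. \<integral>\<^sup>+z. \<integral>\<^sup>+k. bad k u z \<partial>count_space UNIV \<partial>lborel \<partial>?\<sigma>)"
    by (intro nn_integral_cong nn_integral_count_space_nn_integral[symmetric]) auto
  also have "\<dots> \<le> (\<integral>\<^sup>+u. \<integral>\<^sup>+z. ennreal c * ennreal (W u * (1 + log_plus (W u))) * f z \<partial>lborel \<partial>?\<sigma>)"
  proof (intro nn_integral_mono)
    fix u z
    \<comment> \<open>For fixed \<open>u\<close> and \<open>z\<close> only the number of scales \<open>k\<close> with \<open>bad k u z \<noteq> 0\<close> matters.\<close>
    define K where "K = {k. z \<notin> G k \<and> w k z < ennreal (W u)}"
    have "emeasure (count_space UNIV) K \<le> ennreal (c * (1 + log_plus (W u)))"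
      unfolding c_def
    proof (rule emeasure_count_geometric_range[OF \<open>\<delta> > 0\<close>])
      fix i j assume ij: "i \<in> K" "j \<in> K" "i \<le> j"
      then have "ennreal (2 powr (\<delta> * real_of_int (j - i))) \<le> max (w i z) (w j z)"
        by (intro growth) (auto simp: K_def)
      also have "\<dots> < ennreal (W u)" using ij by (auto simp: K_def)
      finally show "2 powr (\<delta> * real_of_int (j - i)) < W u"
        by (simp add: ennreal_less_iff)
    qed
    moreover have "(\<integral>\<^sup>+k. bad k u z \<partial>count_space UNIV) = ennreal (W u) * f z * emeasure (count_space UNIV) K"
    proof -
      have "bad k u z = ennreal (W u) * f z * indicator K k" for k
        by (simp add: bad_def K_def)
      then show ?thesis by (simp add: nn_integral_cmult)
    qed
    ultimately have "(\<integral>\<^sup>+k. bad k u z \<partial>count_space UNIV) \<le> ennreal (W u) * f z * ennreal (c * (1 + log_plus (W u)))"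
      by (simp add: mult_left_mono)
    also have "\<dots> = ennreal c * ennreal (W u * (1 + log_plus (W u))) * f z"
      using c by (cases "W u \<ge> 0") (simp_all add: ennreal_mult ennreal_neg log_plus_def ac_simps mult_nonpos_nonneg)
    finally show "(\<integral>\<^sup>+k. bad k u z \<partial>count_space UNIV) \<le> ennreal c * ennreal (W u * (1 + log_plus (W u))) * f z" .
  qed
  also have "\<dots> = ennreal c * (L * I)"
    by (simp add: nn_integral_cmult nn_integral_multc I_def L_def mult.assoc)
  finally have "level_sum \<gamma> W f (C0 Cb)
    \<le> of_nat N * (\<integral>\<^sup>+k. ennreal (2 powr (\<gamma> * real_of_int k)) * emeasure lborel (G k) \<partial>count_space UNIV)
      + ennreal (2 / C0 Cb) * (ennreal c * (L * I))"
    by (simp add: add_left_mono mult_left_mono)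
  also have "\<dots> \<le> of_nat N * (ennreal Ca * I) + ennreal (2 / C0 Cb) * (ennreal c * (L * I))"
    using small by (intro add_right_mono mult_left_mono) (auto simp: I_def)
  also have "\<dots> = ennreal (real N * Ca) * 1 * I + ennreal (2 / C0 Cb * c) * L * I"
  proof -
    have "ennreal (real N * Ca) = of_nat N * ennreal Ca"
      using pos by (simp add: ennreal_of_nat_eq_real_of_nat ennreal_mult)
    moreover have "ennreal (2 / C0 Cb * c) = ennreal (2 / C0 Cb) * ennreal c"
      using c C0 by (intro ennreal_mult) auto
    ultimately show ?thesis by (simp only: mult.assoc mult_1)
  qed
  also have "\<dots> \<le> ennreal (real N * Ca + 2 / C0 Cb * c) * (1 + L) * I"
  proof -
    have "ennreal (real N * Ca) * 1 + ennreal (2 / C0 Cb * c) * L \<le>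
        ennreal (real N * Ca + 2 / C0 Cb * c) * 1 + ennreal (real N * Ca + 2 / C0 Cb * c) * L"
      using c C0 pos by (intro add_mono mult_right_mono ennreal_leI) auto
    then show ?thesis
      by (simp only: distrib_left[symmetric] distrib_right[symmetric] mult_right_mono zero_le)
  qed
  finally show ?thesis by (simp add: I_def L_def c_def)
qed

section \<open>Geometric sums over integer scales\<close>

lemma two_powr_minus_less_1: "\<theta> > 0 \<Longrightarrow> 2 powr - \<theta> < (1 :: real)"
  using powr_less_cancel_iff[of 2 "- \<theta>" 0] by simp

lemma inverse_antimono_ennreal:
  fixes a b :: ennreal
  assumes "a \<le> b"
  shows "inverse b \<le> inverse a"
  using assms
proof (cases "a = 0 \<or> b = top")
  case False
  then obtain r t where "a = ennreal r" "b = ennreal t" "r > 0" "t > 0" "r \<le> t"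
    using assms by (cases a; cases b) (auto simp: less_le top_unique)
  then show ?thesis by (simp add: inverse_ennreal ennreal_leI)
qed auto

lemma suminf_geometric_powr:
  assumes "\<theta> > 0"
  shows "(\<Sum>i::nat. ennreal (2 powr (- (\<theta> * real i)))) = ennreal (1 / (1 - 2 powr - \<theta>))"
proof -
  have "(\<lambda>i. (2 powr - \<theta>) ^ i) sums (1 / (1 - 2 powr - \<theta>))"
    using assms by (intro geometric_sums) (simp add: two_powr_minus_less_1)
  moreover have "(2 powr - \<theta>) ^ i = 2 powr (- (\<theta> * real i))" for i
    by (simp add: powr_powr flip: powr_realpow)
  ultimately have "(\<lambda>i. 2 powr (- (\<theta> * real i))) sums (1 / (1 - 2 powr - \<theta>))"
    by simp
  then show ?thesis
    by (intro suminf_ennreal_eq) auto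
qed

lemma nn_integral_geometric_up:
  assumes "\<theta> > 0"
  shows "(\<integral>\<^sup>+k. ennreal (2 powr (- (\<theta> * real_of_int (k - k0)))) * indicator {k0..} k \<partial>count_space UNIV)
    = ennreal (1 / (1 - 2 powr - \<theta>))"
proof -
  have bij: "bij_betw (\<lambda>i::nat. k0 + int i) UNIV {k0..}"
    by (rule bij_betwI[where g="\<lambda>k. nat (k - k0)"]) auto
  have "(\<integral>\<^sup>+k. ennreal (2 powr (- (\<theta> * real_of_int (k - k0)))) * indicator {k0..} k \<partial>count_space UNIV)
     = (\<integral>\<^sup>+k. ennreal (2 powr (- (\<theta> * real_of_int (k - k0)))) \<partial>count_space {k0..})"
    by (rule nn_integral_count_space_indicator[symmetric]) (simp add: NO_MATCH_def)
  also have "\<dots> = (\<integral>\<^sup>+i. ennreal (2 powr (- (\<theta> * real i))) \<partial>count_space UNIV)"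
    by (subst nn_integral_bij_count_space[OF bij, symmetric]) simp
  finally show ?thesis
    by (simp add: nn_integral_count_space_nat suminf_geometric_powr[OF assms])
qed

lemma nn_integral_geometric_down:
  assumes "\<theta> > 0"
  shows "(\<integral>\<^sup>+k. ennreal (2 powr (- (\<theta> * real_of_int (k0 - k)))) * indicator {..k0} k \<partial>count_space UNIV)
    = ennreal (1 / (1 - 2 powr - \<theta>))"
proof -
  have bij: "bij_betw (\<lambda>i::nat. k0 - int i) UNIV {..k0}"
    by (rule bij_betwI[where g="\<lambda>k. nat (k0 - k)"]) auto
  have "(\<integral>\<^sup>+k. ennreal (2 powr (- (\<theta> * real_of_int (k0 - k)))) * indicator {..k0} k \<partial>count_space UNIV)
     = (\<integral>\<^sup>+k. ennreal (2 powr (- (\<theta> * real_of_int (k0 - k)))) \<partial>count_space {..k0})"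
    by (rule nn_integral_count_space_indicator[symmetric]) (simp add: NO_MATCH_def)
  also have "\<dots> = (\<integral>\<^sup>+i. ennreal (2 powr (- (\<theta> * real i))) \<partial>count_space UNIV)"
    by (subst nn_integral_bij_count_space[OF bij, symmetric]) simp
  finally show ?thesis
    by (simp add: nn_integral_count_space_nat suminf_geometric_powr[OF assms])
qed

lemma ex_powr_small:
  assumes "\<theta> > 0" "A < top" "(c::real) > 0"
  obtains K :: int where "\<And>k. k \<le> K \<Longrightarrow> ennreal (2 powr (\<theta> * real_of_int k)) * A \<le> ennreal c"
proof -
  obtain a where a: "A = ennreal a" "a \<ge> 0" using assms(2) by (cases A) auto
  define b where "b = c / (a + 1)"
  have b: "b > 0" using a assms by (simp add: b_def)
  show ?thesis
  proof
    fix k assume k: "k \<le> \<lfloor>log 2 b / \<theta>\<rfloor>"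
    then have "real_of_int k \<le> log 2 b / \<theta>" by linarith
    then have "\<theta> * real_of_int k \<le> log 2 b" using assms by (simp add: field_simps)
    then have "2 powr (\<theta> * real_of_int k) \<le> 2 powr (log 2 b)" by simp
    also have "\<dots> = b" using b by simp
    finally have "2 powr (\<theta> * real_of_int k) * a \<le> b * a"
      using a by (simp add: mult_right_mono)
    also have "\<dots> \<le> c" using a assms by (simp add: b_def field_simps)
    finally show "ennreal (2 powr (\<theta> * real_of_int k)) * A \<le> ennreal c"
      using a by (simp add: ennreal_leI flip: ennreal_mult)
  qed
qed

text \<open>
  A geometrically growing sequence that is at most one at all small scales has a first scale at which it
  exceeds one, and from there on its reciprocals are dominated by a geometric series.
\<close>

lemma sum_inverse_geometric:
  fixes r :: "int \<Rightarrow> ennreal"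
  assumes "\<theta> > 0"
    and growth: "\<And>j k. j \<le> k \<Longrightarrow> ennreal (2 powr (\<theta> * real_of_int (k - j))) * r j \<le> r k"
    and small: "\<And>k. k \<le> K \<Longrightarrow> r k \<le> 1"
  shows "(\<integral>\<^sup>+k. inverse (r k) * indicator {k. 1 < r k} k \<partial>count_space UNIV) \<le> ennreal (1 / (1 - 2 powr - \<theta>))"
proof (cases "\<exists>k. 1 < r k")
  case True
  then obtain k1 where k1: "1 < r k1" by blast
  define k0 where "k0 = K + int (LEAST i. 1 < r (K + int i))"
  have "K \<le> k1" using small k1 by (meson leD linear)
  then have "1 < r (K + int (nat (k1 - K)))" using k1 by simp
  then have k0: "1 < r k0" unfolding k0_def by (rule LeastI)
  have ge: "k0 \<le> k" if "1 < r k" for k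
  proof -
    have "K \<le> k" using small that by (meson leD linear)
    moreover have "(LEAST i. 1 < r (K + int i)) \<le> nat (k - K)"
      by (rule Least_le) (use that \<open>K \<le> k\<close> in simp)
    ultimately show ?thesis by (simp add: k0_def)
  qed
  have "(\<integral>\<^sup>+k. inverse (r k) * indicator {k. 1 < r k} k \<partial>count_space UNIV)
     \<le> (\<integral>\<^sup>+k. ennreal (2 powr (- (\<theta> * real_of_int (k - k0)))) * indicator {k0..} k \<partial>count_space UNIV)"
  proof (intro nn_integral_mono)
    fix k
    show "inverse (r k) * indicator {k. 1 < r k} k
      \<le> ennreal (2 powr (- (\<theta> * real_of_int (k - k0)))) * indicator {k0..} k"
    proof (cases "1 < r k")
      case True
      then have k: "k0 \<le> k" by (rule ge)
      have "ennreal (2 powr (\<theta> * real_of_int (k - k0))) * 1 \<le> ennreal (2 powr (\<theta> * real_of_int (k - k0))) * r k0"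
        using k0 by (intro mult_left_mono) auto
      also have "\<dots> \<le> r k" using k by (rule growth)
      finally have "inverse (r k) \<le> inverse (ennreal (2 powr (\<theta> * real_of_int (k - k0))))"
        by (intro inverse_antimono_ennreal) auto
      also have "\<dots> = ennreal (2 powr (- (\<theta> * real_of_int (k - k0))))"
        by (subst inverse_ennreal) (auto simp: powr_minus)
      finally show ?thesis using k True by simp
    qed simp
  qed
  then show ?thesis unfolding nn_integral_geometric_up[OF assms(1)] .
qed simp

lemma borel_measurable_nn_integral_count_space:
  fixes g :: "'a::countable \<Rightarrow> 'b \<Rightarrow> ennreal"
  assumes [measurable]: "\<And>j. g j \<in> borel_measurable M"
  shows "(\<lambda>z. \<integral>\<^sup>+j. g j z \<partial>count_space UNIV) \<in> borel_measurable M"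
proof -
  have "(\<lambda>p. g (fst p) (snd p)) \<in> borel_measurable (count_space UNIV \<Otimes>\<^sub>M M)"
    by (intro measurable_pair_measure_countable1) auto
  then have "(\<lambda>(z, j). g j z) \<in> borel_measurable (M \<Otimes>\<^sub>M count_space UNIV)"
    by (subst measurable_pair_swap_iff) (simp add: case_prod_beta')
  then show ?thesis
    by (rule sigma_finite_measure.borel_measurable_nn_integral[OF sigma_finite_measure_count_space])
qed

section \<open>The exponents below minus the dimension\<close>

text \<open>
  Here \<open>\<theta> = - \<gamma> - n\<close> is positive, and \<open>\<rho> k z = 2^(\<theta> k) * mass f k z\<close> grows at least like \<open>2^(\<theta> k)\<close> in \<open>k\<close> since
  the cubes are nested. The weight is the largest one that \<open>density\<close> admits with constant one, and
  the growth of \<open>\<rho> k\<close> gives \<open>growth\<close> and \<open>small\<close>: \<open>nn_integral_mult_mass\<close> turns the sum of the measures of the \<open>G k\<close> into the integral of \<open>f\<close> against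
  the sum of \<open>1 / \<rho> k\<close> over the scales where \<open>\<rho> k > 1\<close>. On the cubes where \<open>\<rho> k z = 0\<close> the weight is infinite,
  which is harmless because \<open>f\<close> vanishes almost everywhere there.
\<close>

lemma weak_type_negative:
  fixes \<gamma> :: real
  assumes "\<gamma> < - real CARD('n)"
  obtains C0 C1 :: real where "C0 > 0" "C1 > 0"
    "\<And>(W :: real ^ 'n \<Rightarrow> real) f. W \<in> borel_measurable borel \<Longrightarrow> f \<in> borel_measurable borel \<Longrightarrow>
      (\<integral>\<^sup>+z. f z \<partial>lborel) < \<infinity> \<Longrightarrow>
      level_sum \<gamma> W f C0 \<le> ennreal C1 *
         (1 + (\<integral>\<^sup>+u. ennreal (W u * (1 + log_plus (W u))) \<partial>surf)) * (\<integral>\<^sup>+z. f z \<partial>lborel)"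
proof
  let ?n = "real CARD('n)" and ?N = "real (card (neighbour_offsets :: (real ^ 'n) set))"
  define \<theta> where "\<theta> = - \<gamma> - ?n"
  have \<theta>: "\<theta> > 0" using assms by (simp add: \<theta>_def)
  define Ca where "Ca = 1 / (1 - 2 powr - \<theta>)"
  have Ca: "Ca \<ge> 0" using two_powr_minus_less_1[OF \<theta>] by (simp add: Ca_def)
  define C0 where "C0 = 2 * (2 ^ (CARD('n) + 1) * ?N * 1)"
  have "?N > 0" using finite_neighbour_offsets zero_in_neighbour_offsets by (auto simp: card_gt_0_iff)
  then show C0: "C0 > 0" by (simp add: C0_def)
  show "?N * Ca + 2 / C0 * (1 + 1 / (\<theta> * ln 2)) > 0"
    using C0 Ca \<theta> by (intro add_nonneg_pos mult_nonneg_nonneg mult_pos_pos add_pos_pos divide_pos_pos) auto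
  fix W :: "real ^ 'n \<Rightarrow> real" and f :: "real ^ 'n \<Rightarrow> ennreal"
  assume W: "W \<in> borel_measurable borel" and f [measurable]: "f \<in> borel_measurable borel"
    and fin: "(\<integral>\<^sup>+z. f z \<partial>lborel) < \<infinity>"
  define \<rho> where "\<rho> k z = ennreal (2 powr (\<theta> * real_of_int k)) * mass f k z" for k z
  define G where "G k = {z. 1 < \<rho> k z}" for k
  have [measurable]: "\<rho> k \<in> borel_measurable borel" for k
    unfolding \<rho>_def by measurable
  have G_meas [measurable]: "G k \<in> sets borel" for k
    unfolding G_def by measurable
  have mass_fin: "mass f k z < top" for k z
    using mass_le[of f k z] fin by (simp add: order.strict_trans1)
  have \<rho>_fin: "\<rho> k z < top" for k z
    using mass_fin by (simp add: \<rho>_def ennreal_mult_less_top)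
  have \<rho>_cell: "\<rho> k y = \<rho> k z" if "y \<in> cell k z" for k y z
    using mass_cell[OF that] by (simp add: \<rho>_def)
  have grow: "ennreal (2 powr (\<theta> * real_of_int (k - j))) * \<rho> j z \<le> \<rho> k z" if "j \<le> k" for j k z
  proof -
    have "ennreal (2 powr (\<theta> * real_of_int (k - j))) * \<rho> j z = ennreal (2 powr (\<theta> * real_of_int k)) * mass f j z"
    proof -
      have "2 powr (\<theta> * real_of_int (k - j)) * 2 powr (\<theta> * real_of_int j) = 2 powr (\<theta> * real_of_int k)"
        by (simp add: right_diff_distrib flip: powr_add)
      then show ?thesis
        by (simp add: \<rho>_def mult.assoc[symmetric] flip: ennreal_mult)
    qed
    also have "\<dots> \<le> \<rho> k z"
      unfolding \<rho>_def using that by (intro mult_left_mono mass_mono) auto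
    finally show ?thesis .
  qed
  obtain K where K: "\<And>k. k \<le> K \<Longrightarrow> ennreal (2 powr (\<theta> * real_of_int k)) * (\<integral>\<^sup>+z. f z \<partial>lborel) \<le> ennreal 1"
    using ex_powr_small[of \<theta> "\<integral>\<^sup>+z. f z \<partial>lborel" 1] \<theta> fin by auto
  have \<rho>_small: "\<rho> k z \<le> 1" if "k \<le> K" for k z
  proof -
    have "\<rho> k z \<le> ennreal (2 powr (\<theta> * real_of_int k)) * (\<integral>\<^sup>+z. f z \<partial>lborel)"
      unfolding \<rho>_def by (intro mult_left_mono mass_le) simp
    also have "\<dots> \<le> 1" using K[OF that] by simp
    finally show ?thesis .
  qed
  \<comment> \<open>On \<open>G k\<close> the mass is positive and finite, so the indicator of \<open>G k\<close> is \<open>mass f k\<close> times its own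
    reciprocal, and \<open>nn_integral_mult_mass\<close> replaces the factor \<open>mass f k\<close> by \<open>f\<close>.\<close>
  have small_eq: "ennreal (2 powr (\<gamma> * real_of_int k)) * emeasure lborel (G k)
      = (\<integral>\<^sup>+z. f z * (inverse (\<rho> k z) * indicator {k. 1 < \<rho> k z} k) \<partial>lborel)" for k
  proof -
    have inv_mass: "inverse (\<rho> k z) = ennreal (2 powr (- (\<theta> * real_of_int k))) * inverse (mass f k z)"
      if "1 < \<rho> k z" for z
    proof -
      have "mass f k z \<noteq> 0" using that by (auto simp: \<rho>_def)
      then obtain m where "mass f k z = ennreal m" "m > 0"
        using mass_fin[of k z] by (cases "mass f k z") (auto simp: less_le)
      then show ?thesis
        by (simp add: \<rho>_def inverse_ennreal powr_minus flip: ennreal_mult)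
    qed
    have "emeasure lborel (G k) = (\<integral>\<^sup>+z. indicator (G k) z \<partial>lborel)"
      by simp
    also have "\<dots> = (\<integral>\<^sup>+z. (inverse (mass f k z) * indicator (G k) z) * mass f k z \<partial>lborel)"
    proof (intro nn_integral_cong)
      fix z
      show "indicator (G k) z = inverse (mass f k z) * indicator (G k) z * mass f k z"
      proof (cases "z \<in> G k")
        case True
        then have "mass f k z \<noteq> 0" by (auto simp: G_def \<rho>_def)
        then have "inverse (mass f k z) * mass f k z = 1"
          using mass_fin[of k z] by (cases "mass f k z") (auto simp: inverse_ennreal less_le simp flip: ennreal_mult)
        then show ?thesis using True by simp
      qed simp
    qed
    also have "\<dots> = ennreal (2 powr (real_of_int k * ?n)) *
        (\<integral>\<^sup>+z. (inverse (mass f k z) * indicator (G k) z) * f z \<partial>lborel)"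
    proof (rule nn_integral_mult_mass)
      fix y z :: "real ^ 'n" assume "y \<in> cell k z"
      then show "inverse (mass f k y) * indicator (G k) y = inverse (mass f k z) * indicator (G k) z"
        using mass_cell[of y k z f] \<rho>_cell[of y k z] by (simp add: G_def indicator_def)
    qed measurable
    finally have G_eq: "emeasure lborel (G k) = ennreal (2 powr (real_of_int k * ?n)) *
        (\<integral>\<^sup>+z. (inverse (mass f k z) * indicator (G k) z) * f z \<partial>lborel)" .
    have "ennreal (2 powr (\<gamma> * real_of_int k)) * emeasure lborel (G k)
      = ennreal (2 powr (- (\<theta> * real_of_int k))) *
        (\<integral>\<^sup>+z. (inverse (mass f k z) * indicator (G k) z) * f z \<partial>lborel)"
    proof -
      have "2 powr (\<gamma> * real_of_int k) * 2 powr (real_of_int k * ?n) = 2 powr (- (\<theta> * real_of_int k))"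
        by (simp add: \<theta>_def algebra_simps flip: powr_add)
      then show "ennreal (2 powr (\<gamma> * real_of_int k)) * emeasure lborel (G k)
        = ennreal (2 powr (- (\<theta> * real_of_int k))) *
          (\<integral>\<^sup>+z. (inverse (mass f k z) * indicator (G k) z) * f z \<partial>lborel)"
        unfolding G_eq by (simp add: mult.assoc[symmetric] flip: ennreal_mult)
    qed
    also have "\<dots> = (\<integral>\<^sup>+z. ennreal (2 powr (- (\<theta> * real_of_int k))) * ((inverse (mass f k z) * indicator (G k) z) * f z) \<partial>lborel)"
      by (rule nn_integral_cmult[symmetric]) measurable
    also have "\<dots> = (\<integral>\<^sup>+z. f z * (inverse (\<rho> k z) * indicator {k. 1 < \<rho> k z} k) \<partial>lborel)"
      using inv_mass by (intro nn_integral_cong) (auto simp: G_def indicator_def ac_simps)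
    finally show ?thesis .
  qed
  have "(\<integral>\<^sup>+k. ennreal (2 powr (\<gamma> * real_of_int k)) * emeasure lborel (G k) \<partial>count_space UNIV)
    = (\<integral>\<^sup>+z. \<integral>\<^sup>+k. f z * (inverse (\<rho> k z) * indicator {k. 1 < \<rho> k z} k) \<partial>count_space UNIV \<partial>lborel)"
    unfolding small_eq by (rule nn_integral_count_space_nn_integral[symmetric]) (auto simp: indicator_def)
  also have "\<dots> \<le> (\<integral>\<^sup>+z. f z * ennreal Ca \<partial>lborel)"
    using sum_inverse_geometric[of \<theta> "\<lambda>k. \<rho> k z" K for z, OF \<theta> grow \<rho>_small]
    by (intro nn_integral_mono) (simp add: nn_integral_cmult mult_left_mono Ca_def)
  also have "\<dots> = ennreal Ca * (\<integral>\<^sup>+z. f z \<partial>lborel)"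
    by (subst nn_integral_multc) (simp_all add: mult.commute)
  finally have small: "(\<integral>\<^sup>+k. ennreal (2 powr (\<gamma> * real_of_int k)) * emeasure lborel (G k) \<partial>count_space UNIV)
    \<le> ennreal Ca * (\<integral>\<^sup>+z. f z \<partial>lborel)" .
  have density: "mass (\<lambda>y. inverse (\<rho> k y) * f y) k z \<le> ennreal (1 * 2 powr (real_of_int k * (\<gamma> + ?n)))" for k z
  proof -
    have "mass (\<lambda>y. inverse (\<rho> k y) * f y) k z = (\<integral>\<^sup>+y. inverse (\<rho> k z) * (f y * indicator (cell k z) y) \<partial>lborel)"
      unfolding mass_def
    proof (intro nn_integral_cong)
      fix y
      show "inverse (\<rho> k y) * f y * indicator (cell k z) y = inverse (\<rho> k z) * (f y * indicator (cell k z) y)"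
        using \<rho>_cell[of y k z] by (cases "y \<in> cell k z") auto
    qed
    also have "\<dots> = inverse (\<rho> k z) * mass f k z"
      unfolding mass_def by (rule nn_integral_cmult) measurable
    also have "\<dots> \<le> ennreal (2 powr (- (\<theta> * real_of_int k)))"
    proof (cases "mass f k z = 0")
      case False
      then obtain m where "mass f k z = ennreal m" "m > 0"
        using mass_fin[of k z] by (cases "mass f k z") (auto simp: less_le)
      then show ?thesis
        by (simp add: \<rho>_def inverse_ennreal powr_minus flip: ennreal_mult)
    qed simp
    also have "- (\<theta> * real_of_int k) = real_of_int k * (\<gamma> + ?n)"
      by (simp add: \<theta>_def algebra_simps)
    finally show ?thesis by simp
  qed
  have growth: "ennreal (2 powr (\<theta> * real_of_int (k - j))) \<le> max (inverse (\<rho> j z)) (inverse (\<rho> k z))"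
    if "j \<le> k" "z \<notin> G j" "z \<notin> G k" for j k z
  proof -
    have "ennreal (2 powr (- (\<theta> * real_of_int (k - j)))) * (ennreal (2 powr (\<theta> * real_of_int (k - j))) * \<rho> j z)
        \<le> ennreal (2 powr (- (\<theta> * real_of_int (k - j)))) * 1"
      using grow[OF \<open>j \<le> k\<close>, of z] that(3) by (intro mult_left_mono) (auto simp: G_def intro: order_trans)
    then have "\<rho> j z \<le> ennreal (2 powr (- (\<theta> * real_of_int (k - j))))"
      by (simp add: mult.assoc[symmetric] flip: ennreal_mult powr_add)
    then have "inverse (ennreal (2 powr (- (\<theta> * real_of_int (k - j))))) \<le> inverse (\<rho> j z)"
      using \<rho>_fin by (intro inverse_antimono_ennreal) auto
    then have "ennreal (2 powr (\<theta> * real_of_int (k - j))) \<le> inverse (\<rho> j z)"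
      by (simp add: inverse_ennreal powr_minus)
    then show ?thesis by (simp add: le_max_iff_disj)
  qed
  show "level_sum \<gamma> W f C0 \<le> ennreal (?N * Ca + 2 / C0 * (1 + 1 / (\<theta> * ln 2))) *
         (1 + (\<integral>\<^sup>+u. ennreal (W u * (1 + log_plus (W u))) \<partial>surf)) * (\<integral>\<^sup>+z. f z \<partial>lborel)"
    unfolding C0_def
  proof (rule weak_type_of_weights[where G=G and w="\<lambda>k z. inverse (\<rho> k z)"])
    show "y \<in> G k" if "y \<in> cell k z" "z \<in> G k" for k y z
      using that \<rho>_cell by (auto simp: G_def)
  qed (use f W Ca \<theta> small density growth in auto)
qed

section \<open>The positive exponents\<close>

text \<open>
  A cube of side \<open>2^l\<close> is heavy if its mass exceeds \<open>thr l\<close>, that is, if its density exceeds \<open>2^(\<gamma> l)\<close>.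
  A point of \<open>G k\<close> lies in some \<open>H l\<close> with \<open>l \<ge> k\<close>, where \<open>H l\<close> consists of the points for which \<open>l\<close> is the
  last heavy scale; it exists since \<open>f\<close> is integrable. The sets \<open>H l\<close> are disjoint and \<open>2^(\<gamma> l)\<close> times the
  measure of \<open>H l\<close> is at most the integral of \<open>f\<close> over \<open>H l\<close>, so the measures of the \<open>G k\<close> sum up because
  \<open>2^(\<gamma> k)\<close> is summable over \<open>k \<le> l\<close>.
  
  The weight \<open>w k z\<close> sums \<open>2^(\<delta> (k - j))\<close> over the scales \<open>j \<le> k\<close> with \<open>z\<close> outside \<open>G j\<close>. A single term gives the
  separation of scales. The density of \<open>f\<close> outside \<open>G j\<close> is at most \<open>2^(\<gamma> j)\<close>, and with \<open>\<delta> = \<gamma> / 2\<close> the series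
  \<open>2^(\<delta> (k - j) + \<gamma> j)\<close> over \<open>j \<le> k\<close> still converges to a multiple of \<open>2^(\<gamma> k)\<close>. Points outside all \<open>G j\<close> get an
  infinite weight, so that the density bound forces \<open>f\<close> to vanish almost everywhere on the set of these points.
\<close>

lemma weak_type_positive:
  fixes \<gamma> :: real
  assumes "\<gamma> > 0"
  obtains C0 C1 :: real where "C0 > 0" "C1 > 0"
    "\<And>(W :: real ^ 'n \<Rightarrow> real) f. W \<in> borel_measurable borel \<Longrightarrow> f \<in> borel_measurable borel \<Longrightarrow>
      (\<integral>\<^sup>+z. f z \<partial>lborel) < \<infinity> \<Longrightarrow>
      level_sum \<gamma> W f C0 \<le> ennreal C1 *
         (1 + (\<integral>\<^sup>+u. ennreal (W u * (1 + log_plus (W u))) \<partial>surf)) * (\<integral>\<^sup>+z. f z \<partial>lborel)"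
proof
  let ?n = "real CARD('n)" and ?N = "real (card (neighbour_offsets :: (real ^ 'n) set))"
  define \<delta> where "\<delta> = \<gamma> / 2"
  have \<delta>: "\<delta> > 0" using assms by (simp add: \<delta>_def)
  define Ca where "Ca = 1 / (1 - 2 powr - \<gamma>)"
  define Cb where "Cb = 1 / (1 - 2 powr - \<delta>)"
  have Ca: "Ca > 0" using two_powr_minus_less_1[OF assms] by (simp add: Ca_def)
  have Cb: "Cb > 0" using two_powr_minus_less_1[OF \<delta>] by (simp add: Cb_def)
  define C0 where "C0 = 2 * (2 ^ (CARD('n) + 1) * ?N * Cb)"
  have "?N > 0" using finite_neighbour_offsets zero_in_neighbour_offsets by (auto simp: card_gt_0_iff)
  then show C0: "C0 > 0" using Cb by (simp add: C0_def)
  show "?N * Ca + 2 / C0 * (1 + 1 / (\<delta> * ln 2)) > 0"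
    using C0 Ca \<delta> by (intro add_nonneg_pos mult_nonneg_nonneg mult_pos_pos add_pos_pos divide_pos_pos) auto
  fix W :: "real ^ 'n \<Rightarrow> real" and f :: "real ^ 'n \<Rightarrow> ennreal"
  assume W: "W \<in> borel_measurable borel" and f [measurable]: "f \<in> borel_measurable borel"
    and fin: "(\<integral>\<^sup>+z. f z \<partial>lborel) < \<infinity>"
  define thr where "thr l = ennreal (2 powr (real_of_int l * (\<gamma> + ?n)))" for l
  define G where "G k = {z. \<exists>l. k \<le> l \<and> thr l < mass f l z}" for k
  define w where "w k z = (\<integral>\<^sup>+j. ennreal (2 powr (\<delta> * real_of_int (k - j))) * indicator (- G j) z * indicator {..k} j \<partial>count_space UNIV)" for k z
  have G_meas [measurable]: "G k \<in> sets borel" for k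
    unfolding G_def by measurable
  have w_meas [measurable]: "w k \<in> borel_measurable borel" for k
    unfolding w_def by (intro borel_measurable_nn_integral_count_space) measurable
  have G_cell: "y \<in> G k" if "y \<in> cell j z" "z \<in> G k" "j \<le> k" for j k y z
  proof -
    obtain l where l: "k \<le> l" "thr l < mass f l z" using \<open>z \<in> G k\<close> by (auto simp: G_def)
    then have "y \<in> cell l z" using cell_mono[of j l z] that by auto
    then show ?thesis using l mass_cell[of y l z f] by (auto simp: G_def)
  qed
  have G_antimono: "G k \<subseteq> G j" if "j \<le> k" for j k
    using that unfolding G_def by (blast intro: order_trans)
  define H where "H l = G l - G (l + 1)" for l
  have [measurable]: "H l \<in> sets borel" for l unfolding H_def by measurable
  have H_mass: "thr l \<le> mass f l z" if "z \<in> H l" for l z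
  proof -
    have mem: "z \<in> G l" "z \<notin> G (l + 1)" using that by (auto simp: H_def)
    obtain l' where l': "l \<le> l'" "thr l' < mass f l' z" using mem(1) unfolding G_def by blast
    moreover have "\<not> l + 1 \<le> l'" using mem(2) l'(2) unfolding G_def by blast
    ultimately have "l' = l" by simp
    then show ?thesis using l' by simp
  qed
  have H_meas_le: "ennreal (2 powr (\<gamma> * real_of_int l)) * emeasure lborel (H l) \<le> (\<integral>\<^sup>+z. indicator (H l) z * f z \<partial>lborel)" for l
  proof -
    have thr_eq: "ennreal (2 powr (- (real_of_int l * ?n))) * thr l = ennreal (2 powr (\<gamma> * real_of_int l))"
    proof -
      have "2 powr (- (real_of_int l * ?n)) * 2 powr (real_of_int l * (\<gamma> + ?n)) = 2 powr (\<gamma> * real_of_int l)"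
        by (simp add: distrib_left mult.commute flip: powr_add)
      then show ?thesis by (simp add: thr_def flip: ennreal_mult)
    qed
    have "thr l * emeasure lborel (H l) = (\<integral>\<^sup>+z. thr l * indicator (H l) z \<partial>lborel)"
      by (rule nn_integral_cmult_indicator[symmetric]) measurable
    also have "\<dots> \<le> (\<integral>\<^sup>+z. indicator (H l) z * mass f l z \<partial>lborel)"
      using H_mass by (intro nn_integral_mono) (auto simp: indicator_def)
    also have "\<dots> = ennreal (2 powr (real_of_int l * ?n)) * (\<integral>\<^sup>+z. indicator (H l) z * f z \<partial>lborel)"
    proof (rule nn_integral_mult_mass)
      fix y z :: "real ^ 'n" assume "y \<in> cell l z"
      then show "indicator (H l) y = indicator (H l) z"
        using G_cell[of y l z] G_cell[of z l y] by (auto simp: H_def indicator_def cell_sym)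
    qed measurable
    finally have "ennreal (2 powr (- (real_of_int l * ?n))) * (thr l * emeasure lborel (H l))
      \<le> ennreal (2 powr (- (real_of_int l * ?n))) * (ennreal (2 powr (real_of_int l * ?n)) * (\<integral>\<^sup>+z. indicator (H l) z * f z \<partial>lborel))"
      by (intro mult_left_mono) auto
    then show ?thesis
      unfolding mult.assoc[symmetric] thr_eq by (simp flip: ennreal_mult powr_add)
  qed
  have G_eq_H: "indicator (G k) z \<le> (\<integral>\<^sup>+l. indicator (H l) z * indicator {k..} l \<partial>count_space UNIV)" for k z
  proof (cases "z \<in> G k")
    case True
    obtain K where K: "\<And>l. l \<le> K \<Longrightarrow> ennreal (2 powr ((\<gamma> + ?n) * real_of_int l)) * (\<integral>\<^sup>+z. f z \<partial>lborel) \<le> ennreal 1"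
      using ex_powr_small[of "\<gamma> + ?n" "\<integral>\<^sup>+z. f z \<partial>lborel" 1] assms fin by auto
    \<comment> \<open>Large cubes are not heavy: the threshold exceeds the integral of \<open>f\<close>.\<close>
    have light: "mass f l z \<le> thr l" if "- K \<le> l" for l
    proof -
      have e: "2 powr ((\<gamma> + ?n) * real_of_int l) * 2 powr ((\<gamma> + ?n) * real_of_int (- l)) = 1"
        by (simp flip: powr_add)
      have "mass f l z \<le> ennreal (2 powr ((\<gamma> + ?n) * real_of_int l) * 2 powr ((\<gamma> + ?n) * real_of_int (- l))) * (\<integral>\<^sup>+z. f z \<partial>lborel)"
        unfolding e using mass_le by simp
      also have "\<dots> = ennreal (2 powr ((\<gamma> + ?n) * real_of_int l)) * (ennreal (2 powr ((\<gamma> + ?n) * real_of_int (- l))) * (\<integral>\<^sup>+z. f z \<partial>lborel))"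
        by (subst ennreal_mult) (auto simp: mult.assoc)
      also have "\<dots> \<le> ennreal (2 powr ((\<gamma> + ?n) * real_of_int l)) * ennreal 1"
        using that by (intro mult_left_mono K) auto
      finally show ?thesis by (simp add: thr_def mult.commute)
    qed
    have bound: "l < - K" if "z \<in> G l" for l
    proof (rule ccontr)
      assume "\<not> l < - K"
      then show False using light that by (force simp: G_def not_less[symmetric])
    qed
    define i where "i = (GREATEST i. z \<in> G (k + int i))"
    have b: "m \<le> nat (- K - k)" if "z \<in> G (k + int m)" for m
      using bound[OF that] by linarith
    have i: "z \<in> G (k + int i)"
      unfolding i_def
      by (rule GreatestI_nat[where P="\<lambda>i. z \<in> G (k + int i)" and k=0, OF _ b]) (use True in simp_all)
    have "z \<notin> G (k + int i + 1)"
    proof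
      assume "z \<in> G (k + int i + 1)"
      then have Suc_i: "z \<in> G (k + int (Suc i))" by (simp add: algebra_simps)
      have "Suc i \<le> i"
        unfolding i_def
        by (rule Greatest_le_nat[where P="\<lambda>i. z \<in> G (k + int i)", OF _ b]) (use Suc_i in \<open>simp_all add: i_def\<close>)
      then show False by simp
    qed
    then have "z \<in> H (k + int i)" using i by (simp add: H_def)
    then have "indicator (G k) z \<le> (indicator (H (k + int i)) z * indicator {k..} (k + int i) :: ennreal)"
      by (simp add: indicator_def)
    also have "\<dots> \<le> (\<integral>\<^sup>+l. indicator (H l) z * indicator {k..} l \<partial>count_space UNIV)"
      by (rule nn_integral_ge_point[where p="\<lambda>l. indicator (H l) z * indicator {k..} l"]) simp
    finally show ?thesis .
  qed simp
  have H_disjoint: "(\<integral>\<^sup>+l. indicator (H l) z \<partial>count_space UNIV) \<le> 1" for z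
  proof -
    have "l = l'" if "z \<in> H l" "z \<in> H l'" for l l'
      using that G_antimono[of "l + 1" l'] G_antimono[of "l' + 1" l] by (cases l l' rule: linorder_cases) (auto simp: H_def)
    then obtain l0 where "{l. z \<in> H l} \<subseteq> {l0}" by blast
    then have "emeasure (count_space UNIV) {l. z \<in> H l} \<le> emeasure (count_space UNIV) {l0}"
      by (intro emeasure_mono) auto
    moreover have "(\<integral>\<^sup>+l. indicator (H l) z \<partial>count_space UNIV) = (\<integral>\<^sup>+l. indicator {l. z \<in> H l} l \<partial>count_space UNIV)"
      by (intro nn_integral_cong) (simp add: indicator_def)
    ultimately show ?thesis by simp
  qed
  have small: "(\<integral>\<^sup>+k. ennreal (2 powr (\<gamma> * real_of_int k)) * emeasure lborel (G k) \<partial>count_space UNIV)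
    \<le> ennreal Ca * (\<integral>\<^sup>+z. f z \<partial>lborel)"
  proof -
    have "(\<integral>\<^sup>+k. ennreal (2 powr (\<gamma> * real_of_int k)) * emeasure lborel (G k) \<partial>count_space UNIV)
      \<le> (\<integral>\<^sup>+k. \<integral>\<^sup>+l. emeasure lborel (H l) * (ennreal (2 powr (\<gamma> * real_of_int k)) * indicator {k..} l) \<partial>count_space UNIV \<partial>count_space UNIV)"
    proof (intro nn_integral_mono)
      fix k
      have "emeasure lborel (G k) = (\<integral>\<^sup>+z. indicator (G k) z \<partial>lborel)" by simp
      also have "\<dots> \<le> (\<integral>\<^sup>+z. \<integral>\<^sup>+l. indicator (H l) z * indicator {k..} l \<partial>count_space UNIV \<partial>lborel)"
        by (intro nn_integral_mono G_eq_H)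
      also have "\<dots> = (\<integral>\<^sup>+l. \<integral>\<^sup>+z. indicator (H l) z * indicator {k..} l \<partial>lborel \<partial>count_space UNIV)"
        by (rule nn_integral_count_space_nn_integral) auto
      also have "\<dots> = (\<integral>\<^sup>+l. emeasure lborel (H l) * indicator {k..} l \<partial>count_space UNIV)"
        by (simp add: nn_integral_multc)
      finally have "ennreal (2 powr (\<gamma> * real_of_int k)) * emeasure lborel (G k)
        \<le> ennreal (2 powr (\<gamma> * real_of_int k)) * (\<integral>\<^sup>+l. emeasure lborel (H l) * indicator {k..} l \<partial>count_space UNIV)"
        by (intro mult_left_mono) auto
      also have "\<dots> = (\<integral>\<^sup>+l. emeasure lborel (H l) * (ennreal (2 powr (\<gamma> * real_of_int k)) * indicator {k..} l) \<partial>count_space UNIV)"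
        by (simp add: nn_integral_cmult[symmetric] ac_simps)
      finally show "ennreal (2 powr (\<gamma> * real_of_int k)) * emeasure lborel (G k) \<le> \<dots>" .
    qed
    also have "\<dots> = (\<integral>\<^sup>+l. \<integral>\<^sup>+k. emeasure lborel (H l) * (ennreal (2 powr (\<gamma> * real_of_int k)) * indicator {k..} l) \<partial>count_space UNIV \<partial>count_space UNIV)"
      by (rule nn_integral_count_space_nn_integral) auto
    also have "\<dots> = (\<integral>\<^sup>+l. ennreal Ca * (ennreal (2 powr (\<gamma> * real_of_int l)) * emeasure lborel (H l)) \<partial>count_space UNIV)"
    proof (intro nn_integral_cong)
      fix l
      have summand: "ennreal (2 powr (\<gamma> * real_of_int k)) * indicator {k..} l =
          ennreal (2 powr (\<gamma> * real_of_int l)) * (ennreal (2 powr (- (\<gamma> * real_of_int (l - k)))) * indicator {..l} k)" for k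
      proof -
        have "2 powr (\<gamma> * real_of_int l) * 2 powr (- (\<gamma> * real_of_int (l - k))) = 2 powr (\<gamma> * real_of_int k)"
          by (simp add: right_diff_distrib flip: powr_add)
        then show ?thesis by (simp add: indicator_def flip: ennreal_mult)
      qed
      have "(\<integral>\<^sup>+k. ennreal (2 powr (\<gamma> * real_of_int k)) * indicator {k..} l \<partial>count_space UNIV)
        = ennreal (2 powr (\<gamma> * real_of_int l)) * ennreal Ca"
        unfolding summand by (subst nn_integral_cmult) (simp_all only: nn_integral_geometric_down[OF assms] Ca_def borel_measurable_count_space)
      then show "(\<integral>\<^sup>+k. emeasure lborel (H l) * (ennreal (2 powr (\<gamma> * real_of_int k)) * indicator {k..} l) \<partial>count_space UNIV)
        = ennreal Ca * (ennreal (2 powr (\<gamma> * real_of_int l)) * emeasure lborel (H l))"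
        by (subst nn_integral_cmult) (simp_all only: borel_measurable_count_space ac_simps)
    qed
    also have "\<dots> \<le> (\<integral>\<^sup>+l. ennreal Ca * (\<integral>\<^sup>+z. indicator (H l) z * f z \<partial>lborel) \<partial>count_space UNIV)"
      by (intro nn_integral_mono mult_left_mono H_meas_le) auto
    also have "\<dots> = ennreal Ca * (\<integral>\<^sup>+l. \<integral>\<^sup>+z. indicator (H l) z * f z \<partial>lborel \<partial>count_space UNIV)"
      by (rule nn_integral_cmult) simp
    also have "(\<integral>\<^sup>+l. \<integral>\<^sup>+z. indicator (H l) z * f z \<partial>lborel \<partial>count_space UNIV)
      = (\<integral>\<^sup>+z. \<integral>\<^sup>+l. indicator (H l) z * f z \<partial>count_space UNIV \<partial>lborel)"
      by (rule nn_integral_count_space_nn_integral[symmetric]) auto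
    also have "\<dots> \<le> (\<integral>\<^sup>+z. 1 * f z \<partial>lborel)"
    proof (intro nn_integral_mono)
      fix z
      have "(\<integral>\<^sup>+l. indicator (H l) z * f z \<partial>count_space UNIV) = (\<integral>\<^sup>+l. indicator (H l) z \<partial>count_space UNIV) * f z"
        by (rule nn_integral_multc) simp
      then show "(\<integral>\<^sup>+l. indicator (H l) z * f z \<partial>count_space UNIV) \<le> 1 * f z"
        using H_disjoint[of z] by (simp only: mult_right_mono zero_le)
    qed
    finally show ?thesis by (simp add: mult_left_mono)
  qed
  have density: "mass (\<lambda>y. w k y * f y) k z \<le> ennreal (Cb * 2 powr (real_of_int k * (\<gamma> + ?n)))" for k z
  proof -
    \<comment> \<open>Both indicators are constant on the cubes of side \<open>2^j\<close>, so \<open>f\<close> may be replaced by its averages over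
      these cubes, which are at most \<open>2^(\<gamma> j)\<close> outside \<open>G j\<close>.\<close>
    have piece: "(\<integral>\<^sup>+y. (indicator (cell k z) y * indicator (- G j) y) * f y \<partial>lborel)
      \<le> ennreal (2 powr (\<gamma> * real_of_int j + real_of_int k * ?n))" if "j \<le> k" for j
    proof -
      let ?h = "\<lambda>y. indicator (cell k z) y * indicator (- G j) y :: ennreal"
      have "ennreal (2 powr (real_of_int j * ?n)) * (\<integral>\<^sup>+y. ?h y * f y \<partial>lborel) = (\<integral>\<^sup>+y. ?h y * mass f j y \<partial>lborel)"
      proof (rule nn_integral_mult_mass[symmetric])
        fix x y :: "real ^ 'n" assume xy: "x \<in> cell j y"
        have "x \<in> cell k z \<longleftrightarrow> y \<in> cell k z"
          using xy cell_mono[OF that] cell_eq by (metis cell_sym subsetD)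
        moreover have "x \<in> G j \<longleftrightarrow> y \<in> G j"
          using xy G_cell[of x j y j] G_cell[of y j x j] cell_sym by blast
        ultimately show "?h x = ?h y" by (simp add: indicator_def)
      qed measurable
      also have "\<dots> \<le> (\<integral>\<^sup>+y. thr j * indicator (cell k z) y \<partial>lborel)"
        by (intro nn_integral_mono) (auto simp: indicator_def G_def not_less)
      also have "\<dots> = thr j * ennreal (2 powr (real_of_int k * ?n))"
        by (simp add: nn_integral_cmult emeasure_cell)
      finally have "ennreal (2 powr (- (real_of_int j * ?n))) * (ennreal (2 powr (real_of_int j * ?n)) * (\<integral>\<^sup>+y. ?h y * f y \<partial>lborel))
        \<le> ennreal (2 powr (- (real_of_int j * ?n))) * (thr j * ennreal (2 powr (real_of_int k * ?n)))"
        by (rule mult_left_mono) simp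
      also have "\<dots> = ennreal (2 powr (\<gamma> * real_of_int j + real_of_int k * ?n))"
      proof -
        have "2 powr (- (real_of_int j * ?n)) * (2 powr (real_of_int j * (\<gamma> + ?n)) * 2 powr (real_of_int k * ?n))
           = 2 powr (\<gamma> * real_of_int j + real_of_int k * ?n)"
          by (simp add: algebra_simps flip: powr_add)
        then show ?thesis by (simp add: thr_def flip: ennreal_mult)
      qed
      finally show ?thesis
        by (simp add: mult.assoc[symmetric] flip: ennreal_mult powr_add)
    qed
    have "mass (\<lambda>y. w k y * f y) k z = (\<integral>\<^sup>+y. \<integral>\<^sup>+j. ennreal (2 powr (\<delta> * real_of_int (k - j))) * indicator {..k} j *
        ((indicator (cell k z) y * indicator (- G j) y) * f y) \<partial>count_space UNIV \<partial>lborel)"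
      unfolding mass_def w_def
    proof (intro nn_integral_cong)
      fix y
      have "(\<integral>\<^sup>+j. ennreal (2 powr (\<delta> * real_of_int (k - j))) * indicator (- G j) y * indicator {..k} j \<partial>count_space UNIV) *
          (f y * indicator (cell k z) y) =
        (\<integral>\<^sup>+j. ennreal (2 powr (\<delta> * real_of_int (k - j))) * indicator (- G j) y * indicator {..k} j *
          (f y * indicator (cell k z) y) \<partial>count_space UNIV)"
        by (rule nn_integral_multc[symmetric]) simp
      then show "(\<integral>\<^sup>+j. ennreal (2 powr (\<delta> * real_of_int (k - j))) * indicator (- G j) y * indicator {..k} j \<partial>count_space UNIV) *
          f y * indicator (cell k z) y =
        (\<integral>\<^sup>+j. ennreal (2 powr (\<delta> * real_of_int (k - j))) * indicator {..k} j *
          ((indicator (cell k z) y * indicator (- G j) y) * f y) \<partial>count_space UNIV)"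
        by (simp only: ac_simps)
    qed
    also have "\<dots> = (\<integral>\<^sup>+j. \<integral>\<^sup>+y. ennreal (2 powr (\<delta> * real_of_int (k - j))) * indicator {..k} j *
        ((indicator (cell k z) y * indicator (- G j) y) * f y) \<partial>lborel \<partial>count_space UNIV)"
      by (rule nn_integral_count_space_nn_integral) auto
    also have "\<dots> \<le> (\<integral>\<^sup>+j. ennreal (2 powr (real_of_int k * (\<gamma> + ?n))) * (ennreal (2 powr (- (\<delta> * real_of_int (k - j)))) * indicator {..k} j) \<partial>count_space UNIV)"
    proof (intro nn_integral_mono)
      fix j
      have "(\<integral>\<^sup>+y. ennreal (2 powr (\<delta> * real_of_int (k - j))) * indicator {..k} j *
        ((indicator (cell k z) y * indicator (- G j) y) * f y) \<partial>lborel)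
        = ennreal (2 powr (\<delta> * real_of_int (k - j))) * indicator {..k} j *
          (\<integral>\<^sup>+y. (indicator (cell k z) y * indicator (- G j) y) * f y \<partial>lborel)"
        by (rule nn_integral_cmult) measurable
      also have "\<dots> \<le> ennreal (2 powr (real_of_int k * (\<gamma> + ?n))) * (ennreal (2 powr (- (\<delta> * real_of_int (k - j)))) * indicator {..k} j)"
      proof (cases "j \<le> k")
        case True
        have "2 powr (\<delta> * real_of_int (k - j)) * 2 powr (\<gamma> * real_of_int j + real_of_int k * ?n)
          = 2 powr (real_of_int k * (\<gamma> + ?n)) * 2 powr (- (\<delta> * real_of_int (k - j)))"
          by (simp add: \<delta>_def field_simps flip: powr_add)
        then show ?thesis
          using mult_left_mono[OF piece[OF True], of "ennreal (2 powr (\<delta> * real_of_int (k - j)))"] True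
          by (simp flip: ennreal_mult)
      qed simp
      finally show "(\<integral>\<^sup>+y. ennreal (2 powr (\<delta> * real_of_int (k - j))) * indicator {..k} j *
        ((indicator (cell k z) y * indicator (- G j) y) * f y) \<partial>lborel) \<le> \<dots>" .
    qed
    also have "\<dots> = ennreal (2 powr (real_of_int k * (\<gamma> + ?n))) * ennreal Cb"
      by (subst nn_integral_cmult) (simp_all only: nn_integral_geometric_down[OF \<delta>] Cb_def borel_measurable_count_space)
    finally show ?thesis using Cb by (simp add: mult.commute flip: ennreal_mult)
  qed
  have growth: "ennreal (2 powr (\<delta> * real_of_int (k - j))) \<le> max (w j z) (w k z)"
    if "j \<le> k" "z \<notin> G j" "z \<notin> G k" for j k z
  proof -
    have "ennreal (2 powr (\<delta> * real_of_int (k - j))) =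
      ennreal (2 powr (\<delta> * real_of_int (k - j))) * indicator (- G j) z * indicator {..k} j"
      using that by simp
    also have "\<dots> \<le> w k z"
      unfolding w_def by (rule nn_integral_ge_point) simp
    finally show ?thesis by (simp add: le_max_iff_disj)
  qed
  show "level_sum \<gamma> W f C0 \<le> ennreal (?N * Ca + 2 / C0 * (1 + 1 / (\<delta> * ln 2))) *
         (1 + (\<integral>\<^sup>+u. ennreal (W u * (1 + log_plus (W u))) \<partial>surf)) * (\<integral>\<^sup>+z. f z \<partial>lborel)"
    unfolding C0_def
  proof (rule weak_type_of_weights[where G=G and w=w])
    show "y \<in> G k" if "y \<in> cell k z" "z \<in> G k" for k y z
      using that G_cell by blast
  qed (use f W Ca Cb \<delta> small density growth in auto)
qed

section \<open>Scaling and reassembly of the shells\<close>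

lemma level_sum_le_scaled:
  fixes W :: "real ^ 'n \<Rightarrow> real"
  assumes [measurable]: "f \<in> borel_measurable borel" "W \<in> borel_measurable borel" and "\<mu> > 0" "C > 0"
  shows "level_sum \<gamma> W f \<mu> \<le> level_sum \<gamma> W (\<lambda>z. ennreal (C / \<mu>) * f z) C"
  unfolding level_sum_def
proof (intro nn_integral_mono mult_left_mono emeasure_mono)
  fix k
  let ?c = "ennreal (C / \<mu>)" and ?q = "2 powr (\<gamma> * real_of_int k)"
  show "{x. ennreal (\<mu> * ?q) < annular k (\<lambda>u z. ennreal (W u) * f z) x}
    \<subseteq> {x. ennreal (C * ?q) < annular k (\<lambda>u z. ennreal (W u) * (?c * f z)) x}"
  proof safe
    fix x assume less: "ennreal (\<mu> * ?q) < annular k (\<lambda>u z. ennreal (W u) * f z) x"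
    have "annular k (\<lambda>u z. ennreal (W u) * (?c * f z)) x = annular k (\<lambda>u z. ?c * (ennreal (W u) * f z)) x"
      by (simp add: ac_simps)
    also have "\<dots> = ?c * annular k (\<lambda>u z. ennreal (W u) * f z) x"
      by (rule annular_cmult) measurable
    finally have eq: "annular k (\<lambda>u z. ennreal (W u) * (?c * f z)) x = ?c * annular k (\<lambda>u z. ennreal (W u) * f z) x" .
    have "?c * ennreal (\<mu> * ?q) < ?c * annular k (\<lambda>u z. ennreal (W u) * f z) x"
      using less assms(3,4) by (intro ennreal_mult_strict_left_mono) auto
    moreover have "?c * ennreal (\<mu> * ?q) = ennreal (C * ?q)"
      using assms(3,4) by (simp flip: ennreal_mult)
    ultimately show "ennreal (C * ?q) < annular k (\<lambda>u z. ennreal (W u) * (?c * f z)) x"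
      unfolding eq by simp
  qed
qed auto

lemma level_sum_weak_type:
  fixes \<gamma> :: real
  assumes "\<gamma> \<in> {..< - real CARD('n)} \<union> {0<..}"
  obtains C :: real where "C > 0"
    "\<And>(W :: real ^ 'n \<Rightarrow> real) f \<mu>. W \<in> borel_measurable borel \<Longrightarrow> f \<in> borel_measurable borel \<Longrightarrow>
      (\<integral>\<^sup>+z. f z \<partial>lborel) < \<infinity> \<Longrightarrow> \<mu> > 0 \<Longrightarrow>
      level_sum \<gamma> W f \<mu> \<le> ennreal (C / \<mu>) *
         (1 + (\<integral>\<^sup>+u. ennreal (W u * (1 + log_plus (W u))) \<partial>surf)) * (\<integral>\<^sup>+z. f z \<partial>lborel)"
proof -
  obtain C0 C1 :: real where C: "C0 > 0" "C1 > 0"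
    and bound: "\<And>(W :: real ^ 'n \<Rightarrow> real) f. W \<in> borel_measurable borel \<Longrightarrow> f \<in> borel_measurable borel \<Longrightarrow>
      (\<integral>\<^sup>+z. f z \<partial>lborel) < \<infinity> \<Longrightarrow>
      level_sum \<gamma> W f C0 \<le> ennreal C1 *
         (1 + (\<integral>\<^sup>+u. ennreal (W u * (1 + log_plus (W u))) \<partial>surf)) * (\<integral>\<^sup>+z. f z \<partial>lborel)"
  proof (cases "\<gamma> > 0")
    case True
    then show ?thesis using weak_type_positive that by blast
  next
    case False
    then have "\<gamma> < - real CARD('n)" using assms by auto
    then show ?thesis using weak_type_negative that by blast
  qed
  show ?thesis
  proof
    show "C0 * C1 > 0" using C by simp
    fix W :: "real ^ 'n \<Rightarrow> real" and f :: "real ^ 'n \<Rightarrow> ennreal" and \<mu> :: real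
    assume W [measurable]: "W \<in> borel_measurable borel" and f [measurable]: "f \<in> borel_measurable borel"
      and fin: "(\<integral>\<^sup>+z. f z \<partial>lborel) < \<infinity>" and \<mu>: "\<mu> > 0"
    let ?L = "1 + (\<integral>\<^sup>+u. ennreal (W u * (1 + log_plus (W u))) \<partial>surf)"
    have int: "(\<integral>\<^sup>+z. ennreal (C0 / \<mu>) * f z \<partial>lborel) = ennreal (C0 / \<mu>) * (\<integral>\<^sup>+z. f z \<partial>lborel)"
      by (rule nn_integral_cmult) measurable
    have "level_sum \<gamma> W f \<mu> \<le> level_sum \<gamma> W (\<lambda>z. ennreal (C0 / \<mu>) * f z) C0"
      using \<mu> C by (intro level_sum_le_scaled) auto
    also have "\<dots> \<le> ennreal C1 * ?L * (\<integral>\<^sup>+z. ennreal (C0 / \<mu>) * f z \<partial>lborel)"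
      using fin by (intro bound) (auto simp: int ennreal_mult_less_top)
    also have "\<dots> = (ennreal (C0 / \<mu>) * ennreal C1) * ?L * (\<integral>\<^sup>+z. f z \<partial>lborel)"
      unfolding int by (simp only: ac_simps)
    also have "ennreal (C0 / \<mu>) * ennreal C1 = ennreal (C0 * C1 / \<mu>)"
      using C \<mu> by (simp flip: ennreal_mult)
    finally show "level_sum \<gamma> W f \<mu> \<le> ennreal (C0 * C1 / \<mu>) * ?L * (\<integral>\<^sup>+z. f z \<partial>lborel)" .
  qed
qed

text \<open>
  Full segments in place of shells. The radius \<open>2^(k+2)\<close> covers all \<open>r < 2 t\<close> with \<open>t < 2^(k+1)\<close>.
\<close>

definition segmental :: "int \<Rightarrow> (real ^ 'n \<Rightarrow> real ^ 'n \<Rightarrow> ennreal) \<Rightarrow> real ^ 'n \<Rightarrow> ennreal" where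
  "segmental k F x = ennreal (2 powr - real_of_int k) *
     (\<integral>\<^sup>+w. \<integral>\<^sup>+s. F w (x - s *\<^sub>R w) * indicator {- (2 powr (real_of_int k + 2))..2 powr (real_of_int k + 2)} s \<partial>lborel \<partial>surf)"

lemma measurable_segmental [measurable]:
  fixes F :: "real ^ 'n \<Rightarrow> real ^ 'n \<Rightarrow> ennreal"
  assumes [measurable]: "case_prod F \<in> borel_measurable (borel \<Otimes>\<^sub>M borel)"
  shows "segmental k F \<in> borel_measurable borel"
  unfolding segmental_def by measurable

lemma in_some_shell:
  assumes "s \<noteq> 0" "\<bar>s\<bar> \<le> 2 powr real_of_int k"
  obtains m :: nat where "s \<in> shell (k - int m)"
proof
  let ?l = "log 2 \<bar>s\<bar>"
  have s: "\<bar>s\<bar> = 2 powr ?l" using assms(1) by simp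
  have "2 powr ?l \<le> 2 powr real_of_int k" using assms(2) s by simp
  then have "?l \<le> real_of_int k" by simp
  then have e: "k - int (nat (k - \<lceil>?l\<rceil>)) = \<lceil>?l\<rceil>" by (simp add: ceiling_le_iff)
  have "real_of_int \<lceil>?l\<rceil> - 1 < ?l" "?l \<le> real_of_int \<lceil>?l\<rceil>" by linarith+
  then have "2 powr (real_of_int \<lceil>?l\<rceil> - 1) < 2 powr ?l" "2 powr ?l \<le> 2 powr (real_of_int \<lceil>?l\<rceil>)" by simp_all
  then show "s \<in> shell (k - int (nat (k - \<lceil>?l\<rceil>)))"
    unfolding e shell_def using s by simp
qed

lemma le_suminf_ennreal: "h m \<le> (\<Sum>m. h m)" for h :: "nat \<Rightarrow> ennreal"
  using sum_le_suminf[of h "{m}"] by simp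

lemma segmental_le_sum_annular:
  fixes F :: "real ^ 'n \<Rightarrow> real ^ 'n \<Rightarrow> ennreal"
  assumes [measurable]: "case_prod F \<in> borel_measurable (borel \<Otimes>\<^sub>M borel)"
  shows "segmental k F x \<le> (\<Sum>m. ennreal (4 * (1 / 2) ^ m) * annular (k + 2 - int m) F x)"
proof -
  let ?S = "\<lambda>m. shell (k + 2 - int m)"
  let ?I = "\<lambda>m. \<integral>\<^sup>+w. \<integral>\<^sup>+s. F w (x - s *\<^sub>R w) * indicator (?S m) s \<partial>lborel \<partial>surf"
  have "(\<integral>\<^sup>+w. \<integral>\<^sup>+s. F w (x - s *\<^sub>R w) * indicator {- (2 powr (real_of_int k + 2))..2 powr (real_of_int k + 2)} s \<partial>lborel \<partial>surf)
    \<le> (\<integral>\<^sup>+w. \<integral>\<^sup>+s. (\<Sum>m. F w (x - s *\<^sub>R w) * indicator (?S m) s) \<partial>lborel \<partial>surf)"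
  proof (rule nn_integral_mono)
    fix w :: "real ^ 'n"
    show "(\<integral>\<^sup>+s. F w (x - s *\<^sub>R w) * indicator {- (2 powr (real_of_int k + 2))..2 powr (real_of_int k + 2)} s \<partial>lborel)
      \<le> (\<integral>\<^sup>+s. (\<Sum>m. F w (x - s *\<^sub>R w) * indicator (?S m) s) \<partial>lborel)"
    proof (intro nn_integral_mono_AE)
      have "AE s in lborel. s \<noteq> (0 :: real)" by (rule AE_lborel_singleton)
      then show "AE s in lborel. F w (x - s *\<^sub>R w) * indicator {- (2 powr (real_of_int k + 2))..2 powr (real_of_int k + 2)} s
          \<le> (\<Sum>m. F w (x - s *\<^sub>R w) * indicator (?S m) s)"
      proof eventually_elim
        case (elim s)
        show ?case
        proof (cases "\<bar>s\<bar> \<le> 2 powr (real_of_int (k + 2))")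
          case True
          then obtain m where m: "s \<in> ?S m" by (rule in_some_shell[OF elim])
          have "F w (x - s *\<^sub>R w) * indicator {- (2 powr (real_of_int k + 2))..2 powr (real_of_int k + 2)} s
            \<le> F w (x - s *\<^sub>R w) * indicator (?S m) s"
            using m by (auto simp: indicator_def)
          also have "\<dots> \<le> (\<Sum>m. F w (x - s *\<^sub>R w) * indicator (?S m) s)"
            by (rule le_suminf_ennreal[where h="\<lambda>m. F w (x - s *\<^sub>R w) * indicator (?S m) s"])
          finally show ?thesis .
        qed (auto simp: indicator_def)
      qed
    qed
  qed
  also have "\<dots> = (\<integral>\<^sup>+w. (\<Sum>m. \<integral>\<^sup>+s. F w (x - s *\<^sub>R w) * indicator (?S m) s \<partial>lborel) \<partial>surf)"
    by (intro nn_integral_cong nn_integral_suminf) measurable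
  also have "\<dots> = (\<Sum>m. ?I m)"
    by (intro nn_integral_suminf) measurable
  finally have "segmental k F x \<le> ennreal (2 powr - real_of_int k) * (\<Sum>m. ?I m)"
    unfolding segmental_def by (intro mult_left_mono) auto
  also have "\<dots> = (\<Sum>m. ennreal (2 powr - real_of_int k) * ?I m)"
    by (rule ennreal_suminf_cmult[symmetric])
  also have "\<dots> = (\<Sum>m. ennreal (4 * (1 / 2) ^ m) * annular (k + 2 - int m) F x)"
  proof -
    have "2 powr - real_of_int k = 4 * (1 / 2) ^ m * 2 powr - real_of_int (k + 2 - int m)" for m
      by (simp add: powr_diff powr_add powr_minus powr_realpow power_divide field_simps)
    then have pow: "ennreal (2 powr - real_of_int k) = ennreal (4 * (1 / 2) ^ m) * ennreal (2 powr - real_of_int (k + 2 - int m))" for m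
      by (simp flip: ennreal_mult)
    have "ennreal (2 powr - real_of_int k) * ?I m = ennreal (4 * (1 / 2) ^ m) * annular (k + 2 - int m) F x" for m
      unfolding annular_def pow[of m] by (simp only: mult.assoc)
    then show ?thesis by (simp only:)
  qed
  finally show ?thesis .
qed

text \<open>
  If every shell stayed below its threshold, the sum of \<open>4 * (1/2)^m\<close> times \<open>(3/2)^m / 16 * c\<close> would be
  \<open>c / 4\<close> times the sum of \<open>(3/4)^m\<close>, which is exactly \<open>c\<close>. The thresholds may therefore grow with \<open>m\<close>, and this
  growth makes the measures of the level sets summable in \<open>m\<close>.
\<close>

lemma segmental_large_imp_annular_large:
  fixes F :: "real ^ 'n \<Rightarrow> real ^ 'n \<Rightarrow> ennreal"
  assumes [measurable]: "case_prod F \<in> borel_measurable (borel \<Otimes>\<^sub>M borel)"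
    and "c \<ge> 0" and large: "ennreal c < segmental k F x"
  obtains m where "ennreal ((3 / 2) ^ m / 16 * c) < annular (k + 2 - int m) F x"
proof -
  have "\<exists>m. ennreal ((3 / 2) ^ m / 16 * c) < annular (k + 2 - int m) F x"
  proof (rule ccontr)
    assume "\<nexists>m. ennreal ((3 / 2) ^ m / 16 * c) < annular (k + 2 - int m) F x"
    then have le: "annular (k + 2 - int m) F x \<le> ennreal ((3 / 2) ^ m / 16 * c)" for m
      by (simp add: not_less)
    have "segmental k F x \<le> (\<Sum>m. ennreal (4 * (1 / 2) ^ m) * annular (k + 2 - int m) F x)"
      by (rule segmental_le_sum_annular) measurable
    also have "\<dots> \<le> (\<Sum>m. ennreal (4 * (1 / 2) ^ m) * ennreal ((3 / 2) ^ m / 16 * c))"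
      by (intro suminf_le mult_left_mono le) auto
    also have "\<dots> = (\<Sum>m. ennreal (c / 4 * (3 / 4) ^ m))"
    proof -
      have "ennreal (4 * (1 / 2) ^ m) * ennreal ((3 / 2) ^ m / 16 * c) = ennreal (c / 4 * (3 / 4) ^ m)" for m :: nat
      proof -
        have "4 * (1 / 2) ^ m * ((3 / 2) ^ m / 16 * c) = c / 4 * (3 / 4) ^ m"
          by (simp add: power_divide field_simps flip: power_mult_distrib)
        moreover have "(3 / 2) ^ m / 16 * c \<ge> 0" using assms(2) by simp
        ultimately show ?thesis by (metis ennreal_mult'')
      qed
      then show ?thesis by simp
    qed
    also have "\<dots> = ennreal c"
    proof (rule suminf_ennreal_eq)
      show "(\<lambda>m. c / 4 * (3 / 4) ^ m) sums c"
        using sums_mult[OF geometric_sums[of "3 / 4 :: real"], of "c / 4"] by simp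
    qed (use assms(2) in auto)
    finally show False using large by simp
  qed
  then show ?thesis using that by blast
qed

text \<open>
  Passing from scale \<open>k\<close> to the shell \<open>i = k + 2 - m\<close> multiplies the weight \<open>2^(\<gamma> k)\<close> and the level by the same
  power of \<open>2\<close>, so these powers cancel for every sign of \<open>\<gamma>\<close>, and the growth \<open>(3/2)^m\<close> of the
  thresholds leaves the convergent series of \<open>(2/3)^m\<close>.
\<close>

lemma segmental_weak_type:
  fixes \<gamma> :: real
  assumes "\<gamma> \<in> {..< - real CARD('n)} \<union> {0<..}"
  obtains C :: real where "C > 0"
    "\<And>(W :: real ^ 'n \<Rightarrow> real) f \<mu>. W \<in> borel_measurable borel \<Longrightarrow> f \<in> borel_measurable borel \<Longrightarrow>
      (\<integral>\<^sup>+z. f z \<partial>lborel) < \<infinity> \<Longrightarrow> \<mu> > 0 \<Longrightarrow>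
      (\<integral>\<^sup>+k. ennreal (2 powr (\<gamma> * real_of_int k)) *
        emeasure lborel {x. segmental k (\<lambda>u z. ennreal (W u) * f z) x > ennreal (\<mu> * 2 powr (\<gamma> * real_of_int k))}
        \<partial>count_space UNIV)
      \<le> ennreal (C / \<mu>) *
         (1 + (\<integral>\<^sup>+u. ennreal (W u * (1 + log_plus (W u))) \<partial>surf)) * (\<integral>\<^sup>+z. f z \<partial>lborel)"
proof -
  obtain C :: real where C: "C > 0"
    and bound: "\<And>(W :: real ^ 'n \<Rightarrow> real) f \<mu>. W \<in> borel_measurable borel \<Longrightarrow> f \<in> borel_measurable borel \<Longrightarrow>
      (\<integral>\<^sup>+z. f z \<partial>lborel) < \<infinity> \<Longrightarrow> \<mu> > 0 \<Longrightarrow>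
      level_sum \<gamma> W f \<mu> \<le> ennreal (C / \<mu>) *
         (1 + (\<integral>\<^sup>+u. ennreal (W u * (1 + log_plus (W u))) \<partial>surf)) * (\<integral>\<^sup>+z. f z \<partial>lborel)"
    using level_sum_weak_type[OF assms] by blast
  show ?thesis
  proof
    show "48 * C > 0" using C by simp
    fix W :: "real ^ 'n \<Rightarrow> real" and f :: "real ^ 'n \<Rightarrow> ennreal" and \<mu> :: real
    assume W [measurable]: "W \<in> borel_measurable borel" and f [measurable]: "f \<in> borel_measurable borel"
      and fin: "(\<integral>\<^sup>+z. f z \<partial>lborel) < \<infinity>" and \<mu>: "\<mu> > 0"
    define R where "R = (1 + (\<integral>\<^sup>+u. ennreal (W u * (1 + log_plus (W u))) \<partial>surf)) * (\<integral>\<^sup>+z. f z \<partial>lborel)"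
    let ?F = "\<lambda>u z. ennreal (W u) * f z"
    let ?p = "\<lambda>k. 2 powr (\<gamma> * real_of_int k)"
    define A where "A m k = {x. annular (k + 2 - int m) ?F x > ennreal ((3 / 2) ^ m / 16 * (\<mu> * ?p k))}" for m k
    define \<mu>' where "\<mu>' m = (3 / 2) ^ m / 16 * \<mu> * ?p (int m - 2)" for m
    have [measurable]: "A m k \<in> sets borel" for m k unfolding A_def by measurable
    have \<mu>': "\<mu>' m > 0" for m using \<mu> by (simp add: \<mu>'_def)
    have "(\<integral>\<^sup>+k. ennreal (?p k) * emeasure lborel {x. segmental k ?F x > ennreal (\<mu> * ?p k)} \<partial>count_space UNIV)
      \<le> (\<integral>\<^sup>+k. (\<Sum>m. ennreal (?p k) * emeasure lborel (A m k)) \<partial>count_space UNIV)"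
    proof (intro nn_integral_mono)
      fix k
      have "{x. segmental k ?F x > ennreal (\<mu> * ?p k)} \<subseteq> (\<Union>m. A m k)"
      proof
        fix x assume "x \<in> {x. segmental k ?F x > ennreal (\<mu> * ?p k)}"
        then have "ennreal (\<mu> * ?p k) < segmental k ?F x" by simp
        then obtain m where "ennreal ((3 / 2) ^ m / 16 * (\<mu> * ?p k)) < annular (k + 2 - int m) ?F x"
          by (rule segmental_large_imp_annular_large[rotated 2]) (use \<mu> in auto)
        then show "x \<in> (\<Union>m. A m k)" by (auto simp: A_def)
      qed
      then have "emeasure lborel {x. segmental k ?F x > ennreal (\<mu> * ?p k)} \<le> emeasure lborel (\<Union>m. A m k)"
        by (intro emeasure_mono) auto
      also have "\<dots> \<le> (\<Sum>m. emeasure lborel (A m k))"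
        by (intro emeasure_subadditive_countably) auto
      finally show "ennreal (?p k) * emeasure lborel {x. segmental k ?F x > ennreal (\<mu> * ?p k)}
        \<le> (\<Sum>m. ennreal (?p k) * emeasure lborel (A m k))"
        by (simp add: mult_left_mono ennreal_suminf_cmult)
    qed
    also have "\<dots> = (\<Sum>m. \<integral>\<^sup>+k. ennreal (?p k) * emeasure lborel (A m k) \<partial>count_space UNIV)"
      by (rule nn_integral_suminf) simp
    also have "\<dots> \<le> (\<Sum>m. ennreal (16 * C / \<mu> * (2 / 3) ^ m) * R)"
    proof (intro suminf_le)
      fix m
      have bij: "bij_betw (\<lambda>i. i - 2 + int m) UNIV UNIV"
        by (rule bij_betwI[where g="\<lambda>k. k + 2 - int m"]) auto
      have pk: "?p (i - 2 + int m) = ?p (int m - 2) * ?p i" for i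
        by (simp add: algebra_simps flip: powr_add)
      have "(\<integral>\<^sup>+k. ennreal (?p k) * emeasure lborel (A m k) \<partial>count_space UNIV)
        = (\<integral>\<^sup>+i. ennreal (?p (i - 2 + int m)) * emeasure lborel (A m (i - 2 + int m)) \<partial>count_space UNIV)"
        by (rule nn_integral_bij_count_space[OF bij, symmetric])
      also have "\<dots> = (\<integral>\<^sup>+i. ennreal (?p (int m - 2)) * (ennreal (?p i) *
          emeasure lborel {x. annular i ?F x > ennreal (\<mu>' m * ?p i)}) \<partial>count_space UNIV)"
      proof (intro nn_integral_cong)
        fix i
        have "A m (i - 2 + int m) = {x. annular i ?F x > ennreal (\<mu>' m * ?p i)}"
          unfolding A_def pk \<mu>'_def by (simp add: ac_simps)
        then show "ennreal (?p (i - 2 + int m)) * emeasure lborel (A m (i - 2 + int m)) =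
          ennreal (?p (int m - 2)) * (ennreal (?p i) * emeasure lborel {x. annular i ?F x > ennreal (\<mu>' m * ?p i)})"
          unfolding pk by (simp add: ennreal_mult mult.assoc)
      qed
      also have "\<dots> = ennreal (?p (int m - 2)) * level_sum \<gamma> W f (\<mu>' m)"
        unfolding level_sum_def by (rule nn_integral_cmult) simp
      also have "\<dots> \<le> ennreal (?p (int m - 2)) * (ennreal (C / \<mu>' m) * R)"
        using bound[OF W f fin \<mu>'[of m]] by (intro mult_left_mono) (auto simp: R_def mult.assoc)
      also have "\<dots> = ennreal (16 * C / \<mu> * (2 / 3) ^ m) * R"
      proof -
        have "?p (int m - 2) * (C / \<mu>' m) = 16 * C / \<mu> * (2 / 3) ^ m"
          using \<mu> by (simp add: \<mu>'_def field_simps power_divide)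
        moreover have "C / \<mu>' m \<ge> 0" using C \<mu>'[of m] by simp
        ultimately show ?thesis by (metis ennreal_mult mult.assoc powr_ge_zero)
      qed
      finally show "(\<integral>\<^sup>+k. ennreal (?p k) * emeasure lborel (A m k) \<partial>count_space UNIV)
        \<le> ennreal (16 * C / \<mu> * (2 / 3) ^ m) * R" .
    qed auto
    also have "\<dots> = (\<Sum>m. ennreal (16 * C / \<mu> * (2 / 3) ^ m)) * R"
      by (rule ennreal_suminf_multc)
    also have "(\<Sum>m. ennreal (16 * C / \<mu> * (2 / 3) ^ m)) = ennreal (48 * C / \<mu>)"
    proof (rule suminf_ennreal_eq)
      show "(\<lambda>m. 16 * C / \<mu> * (2 / 3) ^ m) sums (48 * C / \<mu>)"
        using sums_mult[OF geometric_sums[of "2 / 3 :: real"], of "16 * C / \<mu>"] by simp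
    qed (use C \<mu> in auto)
    finally show "(\<integral>\<^sup>+k. ennreal (?p k) * emeasure lborel {x. segmental k ?F x > ennreal (\<mu> * ?p k)} \<partial>count_space UNIV)
      \<le> ennreal (48 * C / \<mu>) *
         (1 + (\<integral>\<^sup>+u. ennreal (W u * (1 + log_plus (W u))) \<partial>surf)) * (\<integral>\<^sup>+z. f z \<partial>lborel)"
      by (simp add: R_def mult.assoc)
  qed
qed

section \<open>From the lifted operator to the dyadic averages\<close>

text \<open>
  Equality almost everywhere in space says nothing about the restriction to a given line. A Borel
  function that dominates \<open>\<bar>f\<bar>\<close> everywhere, at the price of being infinite on a null set, controls all
  line integrals, including those of restrictions that are not measurable.
\<close>

lemma borel_majorant:
  fixes f :: "real ^ 'n \<Rightarrow> real"
  assumes "f \<in> borel_measurable lebesgue"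
  obtains g :: "real ^ 'n \<Rightarrow> ennreal" where "g \<in> borel_measurable borel" "\<And>x. ennreal \<bar>f x\<bar> \<le> g x"
    "(\<integral>\<^sup>+x. g x \<partial>lborel) = (\<integral>\<^sup>+x. ennreal \<bar>f x\<bar> \<partial>lebesgue)"
proof -
  have "(\<lambda>x. ennreal \<bar>f x\<bar>) \<in> borel_measurable (completion lborel)"
    using assms by measurable
  then obtain g' where g' [measurable]: "g' \<in> borel_measurable lborel" and ae: "AE x in lborel. ennreal \<bar>f x\<bar> = g' x"
    using completion_ex_borel_measurable by blast
  obtain N where N: "N \<in> null_sets lborel" "{x. ennreal \<bar>f x\<bar> \<noteq> g' x} \<subseteq> N"
    using ae by (auto simp: eventually_ae_filter)
  then have [measurable]: "N \<in> sets borel" by auto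
  define g where "g x = (if x \<in> N then \<infinity> else g' x)" for x
  show ?thesis
  proof
    show "g \<in> borel_measurable borel" unfolding g_def by measurable
    show "ennreal \<bar>f x\<bar> \<le> g x" for x
    proof (cases "x \<in> N")
      case False
      then have "ennreal \<bar>f x\<bar> = g' x" using N(2) by blast
      then show ?thesis using False by (simp add: g_def)
    qed (simp add: g_def)
    have "AE x in lborel. x \<notin> N" using N(1) by (rule AE_not_in)
    with ae have "AE x in lborel. g x = ennreal \<bar>f x\<bar>"
      by eventually_elim (simp add: g_def)
    then show "(\<integral>\<^sup>+x. g x \<partial>lborel) = (\<integral>\<^sup>+x. ennreal \<bar>f x\<bar> \<partial>lebesgue)"
      unfolding nn_integral_completion by (rule nn_integral_cong_AE)
  qed
qed

lemma sphere_borel_version: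
  fixes \<Omega> :: "real ^ 'n \<Rightarrow> real"
  assumes "\<Omega> \<in> borel_measurable sphere_measure"
  obtains W :: "real ^ 'n \<Rightarrow> real" where "W \<in> borel_measurable borel"
    "AE u in sphere_measure. \<bar>\<Omega> u\<bar> = W u"
proof -
  obtain g where g: "g \<in> borel_measurable sphere_borel_measure" "AE u in sphere_borel_measure. \<Omega> u = g u"
    using completion_ex_borel_measurable_real[OF assms[unfolded sphere_measure_def]] by blast
  define W where "W u = \<bar>indicator (sphere 0 1) u *\<^sub>R g u\<bar>" for u
  have "g \<in> borel_measurable (restrict_space borel (sphere 0 1))"
    using g(1) by (simp add: measurable_cong_sets[OF sets_sphere_borel_measure refl])
  then have [measurable]: "(\<lambda>u. indicator (sphere 0 1) u *\<^sub>R g u) \<in> borel_measurable borel"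
    by (subst (asm) borel_measurable_restrict_space_iff) auto
  have "AE u in sphere_measure. \<Omega> u = g u"
    using g(2) unfolding sphere_measure_def by (rule AE_completion)
  moreover have "AE u in sphere_measure. u \<in> sphere (0 :: real ^ 'n) 1"
    using AE_space[of sphere_measure] unfolding space_sphere_measure .
  ultimately have "AE u in sphere_measure. \<bar>\<Omega> u\<bar> = W u"
    by eventually_elim (simp add: W_def)
  moreover have "W \<in> borel_measurable borel" unfolding W_def by measurable
  ultimately show ?thesis using that by blast
qed

text \<open>
  At height \<open>t\<close> in \<open>[2^k, 2^(k+1))\<close> all admissible radii are comparable to \<open>2^k\<close>, so the supremum costs only a
  constant factor.
\<close>

lemma lifted_maximal_le_segmental:
  fixes f :: "real ^ 'n \<Rightarrow> real" and g :: "real ^ 'n \<Rightarrow> ennreal"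
  assumes [measurable]: "g \<in> borel_measurable borel" "W \<in> borel_measurable borel"
    and fg: "\<And>x. ennreal \<bar>f x\<bar> \<le> g x"
    and W: "AE u in sphere_measure. \<bar>\<Omega> u\<bar> = W u"
    and t: "2 powr real_of_int k \<le> t" "t < 2 powr (real_of_int k + 1)"
  shows "lifted_maximal \<Omega> f x t \<le> segmental k (\<lambda>u z. ennreal (W u) * g z) x"
proof -
  let ?b = "2 powr (real_of_int k + 2)"
  let ?J = "\<lambda>w. \<integral>\<^sup>+s. g (x - s *\<^sub>R w) * indicator {- ?b..?b} s \<partial>lborel"
  have t0: "t > 0" using t(1) by (rule less_le_trans[rotated]) simp
  have b: "?b = 2 * 2 powr (real_of_int k + 1)" by (simp add: powr_add)
  have dir: "lifted_directional_maximal w f x t \<le> ennreal (2 powr - real_of_int k) * ?J w" for w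
    unfolding lifted_directional_maximal_def
  proof (rule SUP_least)
    fix r assume r: "r \<in> {t..<2 * t}"
    have "1 / (2 * r) \<le> 1 / 2 powr real_of_int k"
      using r t t0 by (intro divide_left_mono) auto
    then have "ennreal (1 / (2 * r)) \<le> ennreal (2 powr - real_of_int k)"
      unfolding powr_minus_divide by (rule ennreal_leI)
    moreover have "(\<integral>\<^sup>+s\<in>{- r..r}. ennreal \<bar>f (x - s *\<^sub>R w)\<bar> \<partial>lebesgue) \<le> ?J w"
      unfolding nn_integral_completion using r t fg b by (intro nn_integral_mono) (auto simp: indicator_def)
    ultimately show "ennreal (1 / (2 * r)) * (\<integral>\<^sup>+s\<in>{- r..r}. ennreal \<bar>f (x - s *\<^sub>R w)\<bar> \<partial>lebesgue)
        \<le> ennreal (2 powr - real_of_int k) * ?J w"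
      by (intro mult_mono) auto
  qed
  have "lifted_maximal \<Omega> f x t \<le> (\<integral>\<^sup>+w. ennreal (W w) * (ennreal (2 powr - real_of_int k) * ?J w) \<partial>sphere_measure)"
    unfolding lifted_maximal_def
  proof (rule nn_integral_mono_AE)
    show "AE w in sphere_measure. ennreal \<bar>\<Omega> w\<bar> * lifted_directional_maximal w f x t
      \<le> ennreal (W w) * (ennreal (2 powr - real_of_int k) * ?J w)"
      using W by eventually_elim (simp add: dir mult_left_mono)
  qed
  also have "\<dots> = (\<integral>\<^sup>+w. ennreal (W w) * (ennreal (2 powr - real_of_int k) * ?J w) \<partial>surf)"
    by (rule nn_integral_surf[symmetric]) measurable
  also have "\<dots> = (\<integral>\<^sup>+w. ennreal (2 powr - real_of_int k) * (ennreal (W w) * ?J w) \<partial>surf)"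
    by (simp only: ac_simps)
  also have "\<dots> = ennreal (2 powr - real_of_int k) * (\<integral>\<^sup>+w. ennreal (W w) * ?J w \<partial>surf)"
    by (rule nn_integral_cmult) measurable
  also have "\<dots> = segmental k (\<lambda>u z. ennreal (W u) * g z) x"
  proof -
    have "ennreal (W w) * ?J w = (\<integral>\<^sup>+s. ennreal (W w) * g (x - s *\<^sub>R w) * indicator {- ?b..?b} s \<partial>lborel)" for w
      unfolding mult.assoc by (rule nn_integral_cmult[symmetric]) measurable
    then show ?thesis unfolding segmental_def by (simp only:)
  qed
  finally show ?thesis .
qed

lemma nn_integral_dyadic_powr_le:
  fixes \<gamma> :: real
  shows "(\<integral>\<^sup>+t. ennreal (t powr (\<gamma> - 1)) * indicator {2 powr real_of_int k..<2 powr (real_of_int k + 1)} t \<partial>lborel)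
    \<le> ennreal (max 1 (2 powr (\<gamma> - 1)) * 2 powr (\<gamma> * real_of_int k))"
proof -
  let ?a = "2 powr real_of_int k" and ?D = "max 1 (2 powr (\<gamma> - 1))"
  have e: "2 powr (real_of_int k + 1) = 2 * ?a" by (simp add: powr_add)
  have le: "t powr (\<gamma> - 1) \<le> ?D * ?a powr (\<gamma> - 1)" if "?a \<le> t" "t \<le> 2 * ?a" for t
  proof (cases "\<gamma> \<ge> 1")
    case True
    have "t \<ge> 0" using that(1) by (rule order_trans[rotated]) simp
    then have "t powr (\<gamma> - 1) \<le> (2 * ?a) powr (\<gamma> - 1)"
      using that True by (intro powr_mono2) auto
    also have "\<dots> = 2 powr (\<gamma> - 1) * ?a powr (\<gamma> - 1)" by (simp add: powr_mult)
    also have "\<dots> \<le> ?D * ?a powr (\<gamma> - 1)" by (intro mult_right_mono) auto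
    finally show ?thesis .
  next
    case False
    then have "t powr (\<gamma> - 1) \<le> 1 * ?a powr (\<gamma> - 1)"
      using that by (simp add: powr_mono2')
    also have "\<dots> \<le> ?D * ?a powr (\<gamma> - 1)" by (intro mult_right_mono) auto
    finally show ?thesis .
  qed
  have "(\<integral>\<^sup>+t. ennreal (t powr (\<gamma> - 1)) * indicator {?a..<2 powr (real_of_int k + 1)} t \<partial>lborel)
    \<le> (\<integral>\<^sup>+t. ennreal (?D * ?a powr (\<gamma> - 1)) * indicator {?a..<2 * ?a} t \<partial>lborel)"
    unfolding e using le by (intro nn_integral_mono) (auto simp: indicator_def intro!: ennreal_leI)
  also have "\<dots> = ennreal (?D * ?a powr (\<gamma> - 1)) * ennreal ?a"
    by (simp add: nn_integral_cmult_indicator)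
  also have "\<dots> = ennreal (?D * 2 powr (\<gamma> * real_of_int k))"
  proof -
    have "?a powr (\<gamma> - 1) * ?a = 2 powr (\<gamma> * real_of_int k)"
    proof -
      have "real_of_int k * (\<gamma> - 1) + real_of_int k = \<gamma> * real_of_int k"
        by (simp add: algebra_simps)
      then show ?thesis
        unfolding powr_powr powr_add[symmetric] by simp
    qed
    then have "?D * ?a powr (\<gamma> - 1) * ?a = ?D * 2 powr (\<gamma> * real_of_int k)"
      by (simp only: mult.assoc)
    then show ?thesis
      by (metis ennreal_mult'' powr_ge_zero)
  qed
  finally show ?thesis .
qed

theorem theorem3p4:
  fixes \<gamma> :: real
  assumes "CARD('n::finite) \<ge> 2"
    and "\<gamma> \<in> {..< - real CARD('n)} \<union> {0<..}"
  shows "\<exists>C::real. C > 0 \<and>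
    (\<forall>\<Omega> \<in> (LlogL :: (real ^ 'n \<Rightarrow> real) set). \<forall>f :: real ^ 'n \<Rightarrow> real. integrable lebesgue f \<longrightarrow>
      (SUP lam\<in>{0<..}. ennreal lam *
         (\<integral>\<^sup>+y. (\<integral>\<^sup>+t\<in>{t. 0 < t \<and> lifted_maximal \<Omega> f y t > ennreal (lam * t powr \<gamma>)}.
            ennreal (t powr (\<gamma> - 1)) \<partial>lebesgue) \<partial>lebesgue))
      \<le> ennreal C * (1 + LlogL_norm \<Omega>) * (\<integral>\<^sup>+x. ennreal \<bar>f x\<bar> \<partial>lebesgue))"
proof -
  obtain C :: real where C: "C > 0"
    and bound: "\<And>(W :: real ^ 'n \<Rightarrow> real) f \<mu>. W \<in> borel_measurable borel \<Longrightarrow> f \<in> borel_measurable borel \<Longrightarrow>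
      (\<integral>\<^sup>+z. f z \<partial>lborel) < \<infinity> \<Longrightarrow> \<mu> > 0 \<Longrightarrow>
      (\<integral>\<^sup>+k. ennreal (2 powr (\<gamma> * real_of_int k)) *
        emeasure lborel {x. segmental k (\<lambda>u z. ennreal (W u) * f z) x > ennreal (\<mu> * 2 powr (\<gamma> * real_of_int k))}
        \<partial>count_space UNIV)
      \<le> ennreal (C / \<mu>) *
         (1 + (\<integral>\<^sup>+u. ennreal (W u * (1 + log_plus (W u))) \<partial>surf)) * (\<integral>\<^sup>+z. f z \<partial>lborel)"
    using segmental_weak_type[OF assms(2)] by blast
  \<comment> \<open>Relative to their values at the left end of a dyadic interval, \<open>t^(\<gamma> - 1)\<close> is at most \<open>D\<close> and \<open>t^\<gamma>\<close>
    is at least \<open>c\<close> on that interval, whatever the sign of the exponent.\<close>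
  define D where "D = max 1 (2 powr (\<gamma> - 1))"
  define c where "c = min 1 (2 powr \<gamma>)"
  have D: "D > 0" and c: "c > 0" by (simp_all add: D_def c_def)
  have main: "ennreal lam * (\<integral>\<^sup>+y. (\<integral>\<^sup>+t\<in>{t. 0 < t \<and> lifted_maximal \<Omega> f y t > ennreal (lam * t powr \<gamma>)}.
            ennreal (t powr (\<gamma> - 1)) \<partial>lebesgue) \<partial>lebesgue)
      \<le> ennreal (D * C / c) * (1 + LlogL_norm \<Omega>) * (\<integral>\<^sup>+x. ennreal \<bar>f x\<bar> \<partial>lebesgue)"
    if \<Omega>: "\<Omega> \<in> LlogL" and f: "integrable lebesgue f" and lam: "lam > 0"
    for \<Omega> f :: "real ^ 'n \<Rightarrow> real" and lam :: real
  proof -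
    have "f \<in> borel_measurable lebesgue" using f by auto
    then obtain g where g [measurable]: "g \<in> borel_measurable borel"
      and fg: "\<And>x. ennreal \<bar>f x\<bar> \<le> g x"
      and int_g: "(\<integral>\<^sup>+x. g x \<partial>lborel) = (\<integral>\<^sup>+x. ennreal \<bar>f x\<bar> \<partial>lebesgue)"
      using borel_majorant by blast
    have fin: "(\<integral>\<^sup>+x. g x \<partial>lborel) < \<infinity>"
      using f unfolding int_g by (simp add: integrable_iff_bounded)
    obtain W where W [measurable]: "W \<in> borel_measurable borel" and W_ae: "AE u in sphere_measure. \<bar>\<Omega> u\<bar> = W u"
      using \<Omega> sphere_borel_version[of \<Omega>] by (auto simp: LlogL_def)
    have [measurable]: "log_plus \<in> borel_measurable borel"
      unfolding log_plus_def by measurable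
    have norm_W: "(\<integral>\<^sup>+u. ennreal (W u * (1 + log_plus (W u))) \<partial>surf) = LlogL_norm \<Omega>"
    proof -
      have "(\<integral>\<^sup>+u. ennreal (W u * (1 + log_plus (W u))) \<partial>surf) =
          (\<integral>\<^sup>+u. ennreal (W u * (1 + log_plus (W u))) \<partial>sphere_measure)"
        by (rule nn_integral_surf) measurable
      also have "\<dots> = LlogL_norm \<Omega>"
        unfolding LlogL_norm_def
      proof (rule nn_integral_cong_AE)
        show "AE u in sphere_measure. ennreal (W u * (1 + log_plus (W u))) = ennreal (\<bar>\<Omega> u\<bar> * (1 + log_plus \<bar>\<Omega> u\<bar>))"
          using W_ae by eventually_elim simp
      qed
      finally show ?thesis .
    qed
    let ?p = "\<lambda>k. 2 powr (\<gamma> * real_of_int k)"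
    let ?I = "\<lambda>k. {2 powr real_of_int k..<2 powr (real_of_int k + 1)}"
    define S where "S k = {x. segmental k (\<lambda>u z. ennreal (W u) * g z) x > ennreal (lam * c * ?p k)}" for k
    have [measurable]: "S k \<in> sets borel" for k unfolding S_def by measurable
    \<comment> \<open>The set of \<open>t\<close> is decomposed into dyadic intervals; on each of them the condition on \<open>t\<close> is relaxed to one
      on \<open>k\<close> alone, after which all functions are measurable.\<close>
    have inner: "(\<integral>\<^sup>+t\<in>{t. 0 < t \<and> lifted_maximal \<Omega> f y t > ennreal (lam * t powr \<gamma>)}. ennreal (t powr (\<gamma> - 1)) \<partial>lebesgue)
      \<le> (\<integral>\<^sup>+k. ennreal D * (ennreal (?p k) * indicator (S k) y) \<partial>count_space UNIV)" for y
    proof -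
      have "(\<integral>\<^sup>+t\<in>{t. 0 < t \<and> lifted_maximal \<Omega> f y t > ennreal (lam * t powr \<gamma>)}. ennreal (t powr (\<gamma> - 1)) \<partial>lebesgue)
        \<le> (\<integral>\<^sup>+t. \<integral>\<^sup>+k. (ennreal (t powr (\<gamma> - 1)) * indicator (?I k) t) * indicator (S k) y \<partial>count_space UNIV \<partial>lborel)"
        unfolding nn_integral_completion
      proof (intro nn_integral_mono)
        fix t
        show "ennreal (t powr (\<gamma> - 1)) * indicator {t. 0 < t \<and> lifted_maximal \<Omega> f y t > ennreal (lam * t powr \<gamma>)} t
          \<le> (\<integral>\<^sup>+k. (ennreal (t powr (\<gamma> - 1)) * indicator (?I k) t) * indicator (S k) y \<partial>count_space UNIV)"
        proof (cases "0 < t \<and> lifted_maximal \<Omega> f y t > ennreal (lam * t powr \<gamma>)")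
          case True
          define k where "k = \<lfloor>log 2 t\<rfloor>"
          have "real_of_int k \<le> log 2 t" "log 2 t < real_of_int k + 1" by (simp_all add: k_def)
          then have "2 powr real_of_int k \<le> 2 powr log 2 t" "2 powr log 2 t < 2 powr (real_of_int k + 1)"
            by simp_all
          then have t: "2 powr real_of_int k \<le> t" "t < 2 powr (real_of_int k + 1)"
            using True by simp_all
          have "c * ?p k \<le> t powr \<gamma>"
          proof (cases "\<gamma> \<ge> 0")
            case pos: True
            have "c * ?p k \<le> 1 * ?p k" unfolding c_def by (intro mult_right_mono) auto
            also have "\<dots> = (2 powr real_of_int k) powr \<gamma>" by (simp add: powr_powr mult.commute)
            also have "\<dots> \<le> t powr \<gamma>" using t(1) pos by (intro powr_mono2) auto
            finally show ?thesis .
          next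
            case False
            have "c * ?p k \<le> 2 powr \<gamma> * ?p k" unfolding c_def by (intro mult_right_mono) auto
            also have "\<dots> = (2 powr (real_of_int k + 1)) powr \<gamma>"
            proof -
              have "\<gamma> + \<gamma> * real_of_int k = (real_of_int k + 1) * \<gamma>"
                by (simp add: algebra_simps)
              then show ?thesis
                unfolding powr_powr powr_add[symmetric] by simp
            qed
            also have "\<dots> \<le> t powr \<gamma>" using t(2) True False by (intro powr_mono2') auto
            finally show ?thesis .
          qed
          then have "ennreal (lam * c * ?p k) \<le> ennreal (lam * t powr \<gamma>)"
            using lam by (intro ennreal_leI) (simp add: mult.assoc)
          also have "\<dots> < lifted_maximal \<Omega> f y t" using True by simp
          also have "\<dots> \<le> segmental k (\<lambda>u z. ennreal (W u) * g z) y"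
            using t by (intro lifted_maximal_le_segmental g W fg W_ae)
          finally have "y \<in> S k" by (simp add: S_def)
          then have "ennreal (t powr (\<gamma> - 1)) * indicator {t. 0 < t \<and> lifted_maximal \<Omega> f y t > ennreal (lam * t powr \<gamma>)} t
            = (ennreal (t powr (\<gamma> - 1)) * indicator (?I k) t) * indicator (S k) y"
            using t True by simp
          also have "\<dots> \<le> (\<integral>\<^sup>+k. (ennreal (t powr (\<gamma> - 1)) * indicator (?I k) t) * indicator (S k) y \<partial>count_space UNIV)"
            by (rule nn_integral_ge_point) simp
          finally show ?thesis .
        qed simp
      qed
      also have "\<dots> = (\<integral>\<^sup>+k. \<integral>\<^sup>+t. (ennreal (t powr (\<gamma> - 1)) * indicator (?I k) t) * indicator (S k) y \<partial>lborel \<partial>count_space UNIV)"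
        by (rule nn_integral_count_space_nn_integral) auto
      also have "\<dots> \<le> (\<integral>\<^sup>+k. ennreal D * (ennreal (?p k) * indicator (S k) y) \<partial>count_space UNIV)"
      proof (intro nn_integral_mono)
        fix k
        have "(\<integral>\<^sup>+t. (ennreal (t powr (\<gamma> - 1)) * indicator (?I k) t) * indicator (S k) y \<partial>lborel)
          = (\<integral>\<^sup>+t. ennreal (t powr (\<gamma> - 1)) * indicator (?I k) t \<partial>lborel) * indicator (S k) y"
          by (rule nn_integral_multc) measurable
        also have "\<dots> \<le> ennreal (D * ?p k) * indicator (S k) y"
          unfolding D_def by (intro mult_right_mono nn_integral_dyadic_powr_le) auto
        also have "\<dots> = ennreal D * (ennreal (?p k) * indicator (S k) y)"
          using D by (simp add: ennreal_mult mult.assoc)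
        finally show "(\<integral>\<^sup>+t. (ennreal (t powr (\<gamma> - 1)) * indicator (?I k) t) * indicator (S k) y \<partial>lborel)
          \<le> ennreal D * (ennreal (?p k) * indicator (S k) y)" .
      qed
      finally show ?thesis .
    qed
    have "(\<integral>\<^sup>+y. (\<integral>\<^sup>+t\<in>{t. 0 < t \<and> lifted_maximal \<Omega> f y t > ennreal (lam * t powr \<gamma>)}.
            ennreal (t powr (\<gamma> - 1)) \<partial>lebesgue) \<partial>lebesgue)
      \<le> (\<integral>\<^sup>+y. \<integral>\<^sup>+k. ennreal D * (ennreal (?p k) * indicator (S k) y) \<partial>count_space UNIV \<partial>lborel)"
      unfolding nn_integral_completion[of lborel "\<lambda>y. \<integral>\<^sup>+t. h y t \<partial>lebesgue" for h :: "real ^ 'n \<Rightarrow> real \<Rightarrow> ennreal"]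
      by (intro nn_integral_mono inner)
    also have "\<dots> = (\<integral>\<^sup>+k. \<integral>\<^sup>+y. ennreal D * (ennreal (?p k) * indicator (S k) y) \<partial>lborel \<partial>count_space UNIV)"
      by (rule nn_integral_count_space_nn_integral) auto
    also have "\<dots> = (\<integral>\<^sup>+k. ennreal D * (ennreal (?p k) * emeasure lborel (S k)) \<partial>count_space UNIV)"
      by (simp add: nn_integral_cmult nn_integral_cmult_indicator)
    also have "\<dots> = ennreal D * (\<integral>\<^sup>+k. ennreal (?p k) * emeasure lborel (S k) \<partial>count_space UNIV)"
      by (rule nn_integral_cmult) simp
    also have "\<dots> \<le> ennreal D * (ennreal (C / (lam * c)) * (1 + LlogL_norm \<Omega>) * (\<integral>\<^sup>+x. ennreal \<bar>f x\<bar> \<partial>lebesgue))"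
      using bound[OF W g fin, of "lam * c"] lam c
      unfolding norm_W int_g S_def by (intro mult_left_mono) auto
    finally have "ennreal lam * (\<integral>\<^sup>+y. (\<integral>\<^sup>+t\<in>{t. 0 < t \<and> lifted_maximal \<Omega> f y t > ennreal (lam * t powr \<gamma>)}.
            ennreal (t powr (\<gamma> - 1)) \<partial>lebesgue) \<partial>lebesgue)
      \<le> ennreal lam * (ennreal D * (ennreal (C / (lam * c)) * (1 + LlogL_norm \<Omega>) * (\<integral>\<^sup>+x. ennreal \<bar>f x\<bar> \<partial>lebesgue)))"
      by (intro mult_left_mono) auto
    also have "\<dots> = (ennreal lam * (ennreal D * ennreal (C / (lam * c)))) * (1 + LlogL_norm \<Omega>) * (\<integral>\<^sup>+x. ennreal \<bar>f x\<bar> \<partial>lebesgue)"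
      by (simp only: mult.assoc)
    also have "ennreal lam * (ennreal D * ennreal (C / (lam * c))) = ennreal (D * C / c)"
      using lam C D c by (simp flip: ennreal_mult)
    finally show ?thesis .
  qed
  show ?thesis
  proof (intro exI conjI ballI allI impI SUP_least)
    show "D * C / c > 0" using D C c by simp
  qed (use main in auto)
qed

end
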